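(* Let $(r,\Lambda,A)$ be an admissible triple with $\Lambda$ cyclic and $\Lambda\neq\{1\}$. Then the group $\mathrm{F}(r,\Lambda,A)$ (in the pure group signature) interprets the Arithmetic $(\mathbb N,+,\times)$ without parameters.
   Context: An admissible triple $(r,\Lambda,A)$ consists of a real $r>0$, a subgroup $\Lambda$ of the multiplicative group $\mathbb R^*_+$, and an additive subgroup $A\subseteq\mathbb R$ with $r\in A$ and $\lambda A\subseteq A$ for all $\lambda\in\Lambda$. $\mathrm{F}(r,\Lambda,A)$ is the group of all homeomorphisms $x\colon[0,r)\to[0,r)$ (usual topology) that are piecewise affine with finitely many breakpoints, all slopes in $\Lambda$, and all breakpoints and their images in $A$; maps act on the right. An interpretation of $M$ in $N$ without parameters is a pair $(n,f)$ with $f$ a surjection from a subset of $N^n$ onto $M$ such that the preimage of every set $0$-definable in $M$ (under the map induced by $f$ on tuples) is definable in $N$ by a first-order formula without parameters. *)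

theory Defs
  imports "HOL-Analysis.Analysis"
begin

definition mult_subgroup_pos :: "real set \<Rightarrow> bool" where
  "mult_subgroup_pos L \<longleftrightarrow> L \<subseteq> {0<..} \<and> 1 \<in> L \<and>
     (\<forall>a\<in>L. \<forall>b\<in>L. a * b \<in> L) \<and> (\<forall>a\<in>L. inverse a \<in> L)"

definition add_subgroup :: "real set \<Rightarrow> bool" where
  "add_subgroup A \<longleftrightarrow> 0 \<in> A \<and> (\<forall>a\<in>A. \<forall>b\<in>A. a + b \<in> A) \<and> (\<forall>a\<in>A. - a \<in> A)"

definition admissible :: "real \<Rightarrow> real set \<Rightarrow> real set \<Rightarrow> bool" where
  "admissible r L A \<longleftrightarrow> r > 0 \<and> mult_subgroup_pos L \<and> add_subgroup A \<and> r \<in> A \<and>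
     (\<forall>l\<in>L. \<forall>a\<in>A. l * a \<in> A)"

definition cyclic_mult :: "real set \<Rightarrow> bool" where
  "cyclic_mult L \<longleftrightarrow> (\<exists>g. L = {g powi k | k::int. True})"

definition PL_LA :: "real \<Rightarrow> real set \<Rightarrow> real set \<Rightarrow> (real \<Rightarrow> real) \<Rightarrow> bool" where
  "PL_LA r L A x \<longleftrightarrow> (\<exists>p :: real list. \<exists>s :: real list.
      length p \<ge> 2 \<and> length s = length p - 1 \<and>
      p ! 0 = 0 \<and> last p = r \<and> sorted_wrt (<) p \<and> set p \<subseteq> A \<and> set s \<subseteq> L \<and>
      (\<forall>i < length p - 1. x (p ! i) \<in> A \<and>
         (\<forall>t. p ! i \<le> t \<and> t < p ! (Suc i) \<longrightarrow> x t = x (p ! i) + s ! i * (t - p ! i))))"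

definition Fgroup :: "real \<Rightarrow> real set \<Rightarrow> real set \<Rightarrow> (real \<Rightarrow> real) set" where
  "Fgroup r L A = {x. (\<forall>t. t \<notin> {0..<r} \<longrightarrow> x t = t) \<and>
      (\<exists>y. homeomorphism {0..<r} {0..<r} x y) \<and> PL_LA r L A x}"

text \<open>Maps act on the right: the product x*y means first x, then y.\<close>
definition Fmul :: "(real \<Rightarrow> real) \<Rightarrow> (real \<Rightarrow> real) \<Rightarrow> (real \<Rightarrow> real)" where
  "Fmul x y = y \<circ> x"

definition Finv :: "real \<Rightarrow> (real \<Rightarrow> real) \<Rightarrow> (real \<Rightarrow> real)" where
  "Finv r x = (\<lambda>t. if t \<in> {0..<r} then the_inv_into {0..<r} x t else t)"

definition Fone :: "real \<Rightarrow> real" where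
  "Fone = id"

datatype gterm = GVar nat | GOne | GMul gterm gterm | GInv gterm

datatype gfm = GEq gterm gterm | GNot gfm | GAnd gfm gfm | GEx nat gfm

fun gteval :: "('a \<Rightarrow> 'a \<Rightarrow> 'a) \<Rightarrow> ('a \<Rightarrow> 'a) \<Rightarrow> 'a \<Rightarrow> (nat \<Rightarrow> 'a) \<Rightarrow> gterm \<Rightarrow> 'a" where
  "gteval m i e v (GVar n) = v n"
| "gteval m i e v GOne = e"
| "gteval m i e v (GMul s t) = m (gteval m i e v s) (gteval m i e v t)"
| "gteval m i e v (GInv s) = i (gteval m i e v s)"

fun gsat :: "'a set \<Rightarrow> ('a \<Rightarrow> 'a \<Rightarrow> 'a) \<Rightarrow> ('a \<Rightarrow> 'a) \<Rightarrow> 'a \<Rightarrow> (nat \<Rightarrow> 'a) \<Rightarrow> gfm \<Rightarrow> bool" where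
  "gsat G m i e v (GEq s t) = (gteval m i e v s = gteval m i e v t)"
| "gsat G m i e v (GNot f) = (\<not> gsat G m i e v f)"
| "gsat G m i e v (GAnd f g) = (gsat G m i e v f \<and> gsat G m i e v g)"
| "gsat G m i e v (GEx n f) = (\<exists>a\<in>G. gsat G m i e (v(n := a)) f)"

fun gtvars :: "gterm \<Rightarrow> nat set" where
  "gtvars (GVar n) = {n}"
| "gtvars GOne = {}"
| "gtvars (GMul s t) = gtvars s \<union> gtvars t"
| "gtvars (GInv s) = gtvars s"

fun gfree :: "gfm \<Rightarrow> nat set" where
  "gfree (GEq s t) = gtvars s \<union> gtvars t"
| "gfree (GNot f) = gfree f"
| "gfree (GAnd f g) = gfree f \<union> gfree g"
| "gfree (GEx n f) = gfree f - {n}"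

definition gdefinable :: "'a set \<Rightarrow> ('a \<Rightarrow> 'a \<Rightarrow> 'a) \<Rightarrow> ('a \<Rightarrow> 'a) \<Rightarrow> 'a \<Rightarrow> nat \<Rightarrow> 'a list set \<Rightarrow> bool" where
  "gdefinable G m i e k S \<longleftrightarrow> (\<exists>\<phi>. gfree \<phi> \<subseteq> {..<k} \<and>
     S = {xs. length xs = k \<and> set xs \<subseteq> G \<and>
              (\<forall>v. (\<forall>j<k. v j = xs ! j) \<and> range v \<subseteq> G \<longrightarrow> gsat G m i e v \<phi>)})"

datatype aterm = AVar nat | APlus aterm aterm | ATimes aterm aterm

datatype afm = AEq aterm aterm | ANot afm | AAnd afm afm | AEx nat afm

fun ateval :: "(nat \<Rightarrow> nat) \<Rightarrow> aterm \<Rightarrow> nat" where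
  "ateval v (AVar n) = v n"
| "ateval v (APlus s t) = ateval v s + ateval v t"
| "ateval v (ATimes s t) = ateval v s * ateval v t"

fun asat :: "(nat \<Rightarrow> nat) \<Rightarrow> afm \<Rightarrow> bool" where
  "asat v (AEq s t) = (ateval v s = ateval v t)"
| "asat v (ANot f) = (\<not> asat v f)"
| "asat v (AAnd f g) = (asat v f \<and> asat v g)"
| "asat v (AEx n f) = (\<exists>a. asat (v(n := a)) f)"

fun atvars :: "aterm \<Rightarrow> nat set" where
  "atvars (AVar n) = {n}"
| "atvars (APlus s t) = atvars s \<union> atvars t"
| "atvars (ATimes s t) = atvars s \<union> atvars t"

fun afree :: "afm \<Rightarrow> nat set" where
  "afree (AEq s t) = atvars s \<union> atvars t"
| "afree (ANot f) = afree f"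
| "afree (AAnd f g) = afree f \<union> afree g"
| "afree (AEx n f) = afree f - {n}"

definition adefinable :: "nat \<Rightarrow> nat list set \<Rightarrow> bool" where
  "adefinable k S \<longleftrightarrow> (\<exists>\<phi>. afree \<phi> \<subseteq> {..<k} \<and>
     S = {xs. length xs = k \<and> (\<forall>v. (\<forall>j<k. v j = xs ! j) \<longrightarrow> asat v \<phi>)})"

definition interprets_arith :: "'a set \<Rightarrow> ('a \<Rightarrow> 'a \<Rightarrow> 'a) \<Rightarrow> ('a \<Rightarrow> 'a) \<Rightarrow> 'a \<Rightarrow> bool" where
  "interprets_arith G m i e \<longleftrightarrow> (\<exists>n::nat. \<exists>D :: 'a list set. \<exists>f :: 'a list \<Rightarrow> nat.
     D \<subseteq> {xs. length xs = n \<and> set xs \<subseteq> G} \<and> f ` D = UNIV \<and>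
     (\<forall>k S. adefinable k S \<longrightarrow>
        gdefinable G m i e (n * k)
          {concat ys | ys. length ys = k \<and> set ys \<subseteq> D \<and> map f ys \<in> S}))"

end

theory Submission
  imports Defs
begin

text \<open>
  Supports, germs and fixed points of elements of the group are recovered from commutation alone.
  On each component of the support of \<open>u\<close> the centralizer of \<open>u\<close> is abelian, so the commutators
  of that centralizer are supported on the interior of the fixed point set of \<open>u\<close>, and this makes
  ``\<open>u\<close> and \<open>v\<close> have disjoint supports'' first-order (\<open>perp\<close>). Hence so are ``trivial near both
  ends'' (some conjugate has disjoint support; \<open>small\<close>), ``trivial near one end'' (\<open>one_sided\<close>) and
  ``no fixed point in the open interval'' (the centralizer displaces every small element;
  \<open>transitive\<close>).

  Let \<open>\<alpha>\<close> and \<open>\<beta>\<close> be the exponents of the slopes at the two ends with respect to a generator of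
  the slope group. An element without interior fixed points moves all points in the same
  direction, so \<open>\<alpha>\<close> and \<open>\<beta>\<close> have opposite signs; this makes sign comparisons first-order
  (\<open>same_sign\<close>), and with them the condition \<open>\<bar>\<alpha>\<bar> = \<bar>\<beta>\<bar> = 1\<close> (\<open>unit\<close>). If \<open>z\<close> has no interior
  fixed point, an element of its centralizer is determined by its germ at one end, so \<open>(\<alpha>, \<beta>)\<close>
  maps the centralizer of \<open>z\<close> into the line through \<open>(\<alpha> z, \<beta> z)\<close>. If \<open>\<alpha> z = 1\<close> and \<open>\<beta> z = -b\<close>, this is
  the graph of multiplication by \<open>-b\<close>. The natural number \<open>n\<close> is represented by the elements with
  \<open>(\<alpha>, \<beta>) = (n, -n)\<close> or \<open>(-n, n)\<close>, which makes the choice of an end and of an orientation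
  unnecessary.
\<close>

section \<open>First-order definability in a group\<close>

locale fo_group =
  fixes G :: "'a set" and m :: "'a \<Rightarrow> 'a \<Rightarrow> 'a" and i :: "'a \<Rightarrow> 'a" and e :: 'a
  assumes m_closed [simp]: "x \<in> G \<Longrightarrow> y \<in> G \<Longrightarrow> m x y \<in> G"
    and i_closed [simp]: "x \<in> G \<Longrightarrow> i x \<in> G"
    and e_closed [simp]: "e \<in> G"
begin

text \<open>Definability is treated semantically, through functions and predicates of assignments,
  so that it is proved by composing closure rules instead of writing out composite formulas.\<close>

definition term_fun :: "nat set \<Rightarrow> ((nat \<Rightarrow> 'a) \<Rightarrow> 'a) \<Rightarrow> bool" where
  "term_fun X g \<longleftrightarrow> (\<exists>s. gtvars s \<subseteq> X \<and> (\<forall>v. g v = gteval m i e v s))"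

text \<open>Agreement is required only on assignments with values in \<open>G\<close>, since nothing
  is assumed about the operations outside \<open>G\<close>. These are also the assignments that
  occur in \<open>gdefinable\<close>.\<close>

definition fo_pred :: "nat set \<Rightarrow> ((nat \<Rightarrow> 'a) \<Rightarrow> bool) \<Rightarrow> bool" where
  "fo_pred X P \<longleftrightarrow> (\<exists>\<phi>. gfree \<phi> \<subseteq> X \<and> (\<forall>v. range v \<subseteq> G \<longrightarrow> gsat G m i e v \<phi> = P v))"

lemma gteval_cong: "(\<And>n. n \<in> gtvars s \<Longrightarrow> v n = w n) \<Longrightarrow> gteval m i e v s = gteval m i e w s"
  by (induction s) auto

lemma gteval_closed: "range v \<subseteq> G \<Longrightarrow> gteval m i e v s \<in> G"
  by (induction s) auto

lemma term_fun_var: "n \<in> X \<Longrightarrow> term_fun X (\<lambda>v. v n)"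
  unfolding term_fun_def by (intro exI[of _ "GVar n"]) auto

lemma term_fun_one: "term_fun X (\<lambda>v. e)"
  unfolding term_fun_def by (intro exI[of _ GOne]) auto

lemma term_fun_mul: "term_fun X g \<Longrightarrow> term_fun X h \<Longrightarrow> term_fun X (\<lambda>v. m (g v) (h v))"
  unfolding term_fun_def
  by (elim exE conjE, rename_tac s t, rule_tac x = "GMul s t" in exI) auto

lemma term_fun_inv: "term_fun X g \<Longrightarrow> term_fun X (\<lambda>v. i (g v))"
  unfolding term_fun_def
  by (elim exE conjE, rename_tac s, rule_tac x = "GInv s" in exI) auto

lemma term_fun_mono: "term_fun X g \<Longrightarrow> X \<subseteq> Y \<Longrightarrow> term_fun Y g"
  unfolding term_fun_def by blast

lemma term_fun_upd: "term_fun X g \<Longrightarrow> n \<notin> X \<Longrightarrow> g (v(n := a)) = g v"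
  unfolding term_fun_def by (elim exE conjE) (simp, rule gteval_cong, auto)

lemma term_fun_closed: "term_fun X g \<Longrightarrow> range v \<subseteq> G \<Longrightarrow> g v \<in> G"
  unfolding term_fun_def by (auto intro: gteval_closed)

lemma fo_pred_eq: "term_fun X g \<Longrightarrow> term_fun X h \<Longrightarrow> fo_pred X (\<lambda>v. g v = h v)"
  unfolding term_fun_def fo_pred_def
  by (elim exE conjE, rename_tac s t, rule_tac x = "GEq s t" in exI) auto

lemma fo_pred_not: "fo_pred X P \<Longrightarrow> fo_pred X (\<lambda>v. \<not> P v)"
  unfolding fo_pred_def
  by (elim exE conjE, rename_tac s, rule_tac x = "GNot s" in exI) auto

lemma fo_pred_and: "fo_pred X P \<Longrightarrow> fo_pred X Q \<Longrightarrow> fo_pred X (\<lambda>v. P v \<and> Q v)"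
  unfolding fo_pred_def
  by (elim exE conjE, rename_tac s t, rule_tac x = "GAnd s t" in exI) auto

lemma fo_pred_or: "fo_pred X P \<Longrightarrow> fo_pred X Q \<Longrightarrow> fo_pred X (\<lambda>v. P v \<or> Q v)"
  using fo_pred_not[OF fo_pred_and[OF fo_pred_not fo_pred_not], of X P Q] by simp

lemma fo_pred_imp: "fo_pred X P \<Longrightarrow> fo_pred X Q \<Longrightarrow> fo_pred X (\<lambda>v. P v \<longrightarrow> Q v)"
  unfolding imp_conv_disj by (intro fo_pred_or fo_pred_not)

lemma fo_pred_cong:
  assumes "fo_pred X P" "\<And>v. range v \<subseteq> G \<Longrightarrow> P v = Q v"
  shows "fo_pred X Q"
proof -
  obtain \<phi> where "gfree \<phi> \<subseteq> X" "\<And>v. range v \<subseteq> G \<Longrightarrow> gsat G m i e v \<phi> = P v"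
    using assms(1) unfolding fo_pred_def by blast
  then show ?thesis unfolding fo_pred_def using assms(2) by (intro exI[of _ \<phi>]) simp
qed

lemma fo_pred_mono: "fo_pred X P \<Longrightarrow> X \<subseteq> Y \<Longrightarrow> fo_pred Y P"
  unfolding fo_pred_def by blast

lemma fo_pred_ex_upd:
  assumes "fo_pred (insert n X) P"
  shows "fo_pred X (\<lambda>v. \<exists>a\<in>G. P (v(n := a)))"
proof -
  obtain \<phi> where "gfree \<phi> \<subseteq> insert n X" and \<phi>: "\<And>v. range v \<subseteq> G \<Longrightarrow> gsat G m i e v \<phi> = P v"
    using assms unfolding fo_pred_def by blast
  then have "gfree (GEx n \<phi>) \<subseteq> X" by auto
  moreover have "gsat G m i e v (GEx n \<phi>) = (\<exists>a\<in>G. P (v(n := a)))" if "range v \<subseteq> G" for v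
  proof -
    have "range (v(n := a)) \<subseteq> G" if "a \<in> G" for a
      using that \<open>range v \<subseteq> G\<close> by (auto simp: image_subset_iff)
    then show ?thesis using \<phi> by auto
  qed
  ultimately show ?thesis unfolding fo_pred_def by blast
qed

text \<open>The bound element is a separate argument of \<open>Q\<close>, so the rule applies
  directly to bodies written with a bounded quantifier of the logic. Finiteness of \<open>X\<close>
  provides a fresh index for the bound variable; the last premise says that the assignment at such
  an index does not affect \<open>Q a\<close>.\<close>

lemma fo_pred_ex:
  assumes "finite X" "\<And>n. n \<notin> X \<Longrightarrow> fo_pred (insert n X) (\<lambda>v. Q (v n) v)"
    and "\<And>n a v. n \<notin> X \<Longrightarrow> Q a (v(n := a)) = Q a v"
  shows "fo_pred X (\<lambda>v. \<exists>a\<in>G. Q a v)"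
proof -
  obtain n where n: "n \<notin> X" using assms(1) ex_new_if_finite infinite_UNIV_nat by blast
  show ?thesis using fo_pred_ex_upd[OF assms(2)[OF n]] by (simp add: assms(3)[OF n])
qed

lemma fo_pred_all:
  assumes "finite X" "\<And>n. n \<notin> X \<Longrightarrow> fo_pred (insert n X) (\<lambda>v. Q (v n) v)"
    and "\<And>n a v. n \<notin> X \<Longrightarrow> Q a (v(n := a)) = Q a v"
  shows "fo_pred X (\<lambda>v. \<forall>a\<in>G. Q a v)"
  using fo_pred_not[OF fo_pred_ex[of X "\<lambda>a v. \<not> Q a v"]] assms by (simp add: fo_pred_not)

section \<open>First-order predicates for supports, end germs and numbers\<close>

definition conj_by :: "'a \<Rightarrow> 'a \<Rightarrow> 'a" where
  "conj_by x h = m (m (i h) x) h"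

definition commutator :: "'a \<Rightarrow> 'a \<Rightarrow> 'a" where
  "commutator a b = m (i (m b a)) (m a b)"

definition commute :: "'a \<Rightarrow> 'a \<Rightarrow> bool" where
  "commute x y \<longleftrightarrow> m x y = m y x"

text \<open>For piecewise affine maps, the commutators of the centralizer of \<open>u\<close> fix
  the support of \<open>u\<close> pointwise, so every \<open>w\<close> supported there qualifies.
  Conversely, a \<open>w\<close> that qualifies fixes every interior point near which
  \<open>u\<close> is trivial.\<close>

definition subsupp :: "'a \<Rightarrow> 'a \<Rightarrow> bool" where
  "subsupp w u \<longleftrightarrow> (\<forall>a\<in>G. \<forall>b\<in>G. commute a u \<and> commute b u \<longrightarrow> commute w (commutator a b))"

definition perp :: "'a \<Rightarrow> 'a \<Rightarrow> bool" where
  "perp u v \<longleftrightarrow> (\<forall>w\<in>G. subsupp w u \<longrightarrow> commute w v)"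

text \<open>Conjugation preserves the slopes at both ends, and two elements with nontrivial germs at
  the same end cannot have disjoint supports.\<close>

definition small :: "'a \<Rightarrow> bool" where
  "small x \<longleftrightarrow> (\<exists>h\<in>G. perp (conj_by x h) x)"

text \<open>The witness \<open>y\<close> has a nontrivial germ at some end, and disjointness makes
  \<open>x\<close> trivial near that end. Which end it is remains unspecified.\<close>

definition one_sided :: "'a \<Rightarrow> bool" where
  "one_sided x \<longleftrightarrow> (\<exists>y\<in>G. \<not> small y \<and> perp y x)"

text \<open>If all elements of the centralizer fixed a common interior point, a small
  \<open>u\<close> moving that point could not be displaced. The identity is excluded separately:
  its centralizer is the whole group, which displaces every small element.\<close>

definition transitive :: "'a \<Rightarrow> bool" where
  "transitive z \<longleftrightarrow> z \<noteq> e \<and> (\<forall>u\<in>G. small u \<longrightarrow> (\<exists>h\<in>G. commute h z \<and> perp (conj_by u h) u))"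

definition same_sign :: "'a \<Rightarrow> 'a \<Rightarrow> bool" where
  "same_sign x y \<longleftrightarrow> (\<exists>w\<in>G. transitive w \<and> one_sided (m (i w) x) \<and> one_sided (m (i w) y))"

text \<open>At neither end may the exponent of \<open>z\<close> split into two nonzero integers of
  its own sign, which leaves only \<open>1\<close> and \<open>-1\<close>. The product of
  \<open>a\<close> and \<open>b\<close> has to match \<open>z\<close> at one end only, so at the
  other end just the signs matter.\<close>

definition unit :: "'a \<Rightarrow> bool" where
  "unit z \<longleftrightarrow> transitive z \<and> \<not> (\<exists>a\<in>G. \<exists>b\<in>G. transitive a \<and> transitive b \<and>
     same_sign a z \<and> same_sign b z \<and> one_sided (m (i z) (m a b)))"

definition num :: "'a \<Rightarrow> bool" where
  "num x \<longleftrightarrow> (\<exists>t\<in>G. unit t \<and> commute x t)"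

definition num_eq :: "'a \<Rightarrow> 'a \<Rightarrow> bool" where
  "num_eq x y \<longleftrightarrow> small (m x y) \<or> small (m x (i y))"

text \<open>Numbers are absolute values of exponents, so the orientation of \<open>y\<close> is
  adjusted to that of \<open>x\<close> before multiplying. Trivial elements have no orientation and
  are treated separately.\<close>

definition num_add :: "'a \<Rightarrow> 'a \<Rightarrow> 'a \<Rightarrow> bool" where
  "num_add x y z \<longleftrightarrow> small x \<and> num_eq y z \<or> small y \<and> num_eq x z \<or>
     same_sign x y \<and> num_eq (m x y) z \<or> same_sign x (i y) \<and> num_eq (m x (i y)) z"

text \<open>In the intended use \<open>d\<close> marks an end, the only one at which its germ is
  nontrivial. Being one-sided both before and after multiplication by \<open>d\<close> forces
  \<open>m x (i y)\<close> to be trivial at the other end.\<close>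

definition agree_off :: "'a \<Rightarrow> 'a \<Rightarrow> 'a \<Rightarrow> bool" where
  "agree_off d x y \<longleftrightarrow> one_sided (m x (i y)) \<and> one_sided (m (m x (i y)) d)"

text \<open>\<open>c\<close> and \<open>d\<close> mark different ends. \<open>z\<close> agrees with
  a unit away from \<open>c\<close> and with \<open>y\<close> away from \<open>d\<close>, so on its
  centralizer the two exponents differ by the factor given by \<open>y\<close>, up to sign;
  \<open>u\<close> is an element of this centralizer that lies over \<open>x\<close>. A small
  \<open>y\<close> is treated separately because a transitive \<open>z\<close> is trivial at neither
  end.\<close>

definition num_mult :: "'a \<Rightarrow> 'a \<Rightarrow> 'a \<Rightarrow> bool" where
  "num_mult x y w \<longleftrightarrow> small y \<and> small w \<or>
     (\<exists>c\<in>G. \<exists>d\<in>G. \<exists>t\<in>G. \<exists>z\<in>G. \<exists>u\<in>G. one_sided c \<and> one_sided d \<and> \<not> one_sided (m c d) \<and>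
        unit t \<and> transitive z \<and> commute u z \<and>
        agree_off c z t \<and> agree_off d z y \<and> agree_off c u x \<and> (agree_off d u w \<or> agree_off d u (i w)))"

lemmas fo_intros = fo_pred_eq fo_pred_not fo_pred_and fo_pred_or fo_pred_imp
  fo_pred_ex fo_pred_all term_fun_one term_fun_mul term_fun_inv

lemma fo_pred_commute:
  "term_fun X g \<Longrightarrow> term_fun X h \<Longrightarrow> fo_pred X (\<lambda>v. commute (g v) (h v))"
  unfolding commute_def by (intro fo_intros)

lemma term_fun_conj_by:
  "term_fun X g \<Longrightarrow> term_fun X h \<Longrightarrow> term_fun X (\<lambda>v. conj_by (g v) (h v))"
  unfolding conj_by_def by (intro fo_intros)

lemma term_fun_commutator:
  "term_fun X g \<Longrightarrow> term_fun X h \<Longrightarrow> term_fun X (\<lambda>v. commutator (g v) (h v))"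
  unfolding commutator_def by (intro fo_intros)

lemma fo_pred_subsupp:
  "finite X \<Longrightarrow> term_fun X g \<Longrightarrow> term_fun X h \<Longrightarrow> fo_pred X (\<lambda>v. subsupp (g v) (h v))"
  unfolding subsupp_def
  by (intro fo_intros fo_pred_commute term_fun_commutator)
    (auto simp: term_fun_upd intro: term_fun_var term_fun_mono)

lemma fo_pred_perp:
  "finite X \<Longrightarrow> term_fun X g \<Longrightarrow> term_fun X h \<Longrightarrow> fo_pred X (\<lambda>v. perp (g v) (h v))"
  unfolding perp_def
  by (intro fo_intros fo_pred_commute fo_pred_subsupp)
    (auto simp: term_fun_upd intro: term_fun_var term_fun_mono)

lemma fo_pred_small: "finite X \<Longrightarrow> term_fun X g \<Longrightarrow> fo_pred X (\<lambda>v. small (g v))"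
  unfolding small_def
  by (intro fo_intros fo_pred_perp term_fun_conj_by)
    (auto simp: term_fun_upd intro: term_fun_var term_fun_mono)

lemma fo_pred_one_sided: "finite X \<Longrightarrow> term_fun X g \<Longrightarrow> fo_pred X (\<lambda>v. one_sided (g v))"
  unfolding one_sided_def
  by (intro fo_intros fo_pred_small fo_pred_perp)
    (auto simp: term_fun_upd intro: term_fun_var term_fun_mono)

lemma fo_pred_transitive: "finite X \<Longrightarrow> term_fun X g \<Longrightarrow> fo_pred X (\<lambda>v. transitive (g v))"
  unfolding transitive_def
  by (intro fo_intros fo_pred_small fo_pred_perp fo_pred_commute term_fun_conj_by)
    (auto simp: term_fun_upd intro: term_fun_var term_fun_mono)

lemma fo_pred_same_sign:
  "finite X \<Longrightarrow> term_fun X g \<Longrightarrow> term_fun X h \<Longrightarrow> fo_pred X (\<lambda>v. same_sign (g v) (h v))"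
  unfolding same_sign_def
  by (intro fo_intros fo_pred_transitive fo_pred_one_sided)
    (auto simp: term_fun_upd intro: term_fun_var term_fun_mono)

lemma fo_pred_unit: "finite X \<Longrightarrow> term_fun X g \<Longrightarrow> fo_pred X (\<lambda>v. unit (g v))"
  unfolding unit_def
  by (intro fo_intros fo_pred_transitive fo_pred_one_sided fo_pred_same_sign)
    (auto simp: term_fun_upd intro: term_fun_var term_fun_mono)

lemma fo_pred_num: "finite X \<Longrightarrow> term_fun X g \<Longrightarrow> fo_pred X (\<lambda>v. num (g v))"
  unfolding num_def
  by (intro fo_intros fo_pred_unit fo_pred_commute)
    (auto simp: term_fun_upd intro: term_fun_var term_fun_mono)

lemma fo_pred_num_eq:
  "finite X \<Longrightarrow> term_fun X g \<Longrightarrow> term_fun X h \<Longrightarrow> fo_pred X (\<lambda>v. num_eq (g v) (h v))"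
  unfolding num_eq_def by (intro fo_intros fo_pred_small)

lemma fo_pred_num_add:
  "finite X \<Longrightarrow> term_fun X g \<Longrightarrow> term_fun X h \<Longrightarrow> term_fun X k \<Longrightarrow>
    fo_pred X (\<lambda>v. num_add (g v) (h v) (k v))"
  unfolding num_add_def by (intro fo_intros fo_pred_small fo_pred_num_eq fo_pred_same_sign)

lemma fo_pred_agree_off:
  "finite X \<Longrightarrow> term_fun X g \<Longrightarrow> term_fun X h \<Longrightarrow> term_fun X k \<Longrightarrow>
    fo_pred X (\<lambda>v. agree_off (g v) (h v) (k v))"
  unfolding agree_off_def by (intro fo_intros fo_pred_one_sided)

lemma fo_pred_num_mult:
  "finite X \<Longrightarrow> term_fun X g \<Longrightarrow> term_fun X h \<Longrightarrow> term_fun X k \<Longrightarrow>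
    fo_pred X (\<lambda>v. num_mult (g v) (h v) (k v))"
  unfolding num_mult_def
  by (intro fo_intros fo_pred_small fo_pred_one_sided fo_pred_unit fo_pred_transitive
      fo_pred_commute fo_pred_agree_off)
    (auto simp: term_fun_upd intro: term_fun_var term_fun_mono)

end

section \<open>Translation of arithmetic formulas into group formulas\<close>

lemma ateval_cong: "(\<And>n. n \<in> atvars s \<Longrightarrow> v n = w n) \<Longrightarrow> ateval v s = ateval w s"
  by (induction s) auto

lemma asat_cong: "(\<And>n. n \<in> afree \<phi> \<Longrightarrow> v n = w n) \<Longrightarrow> asat v \<phi> = asat w \<phi>"
proof (induction \<phi> arbitrary: v w)
  case (AEq s t)
  then show ?case using ateval_cong[of s v w] ateval_cong[of t v w] by simp
next
  case (AEx n \<phi>)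
  have "asat (v(n := a)) \<phi> = asat (w(n := a)) \<phi>" for a
    by (rule AEx.IH) (use AEx.prems in auto)
  then show ?case by simp
next
  case (AAnd a b)
  then show ?case by (metis UnCI afree.simps(3) asat.simps(3))
next
  case (ANot \<phi>)
  have "asat v \<phi> = asat w \<phi>" by (rule ANot.IH) (use ANot.prems in auto)
  then show ?case by simp
qed

lemma finite_atvars: "finite (atvars s)" by (induction s) auto
lemma finite_afree: "finite (afree \<phi>)" by (induction \<phi>) (auto simp: finite_atvars)

context fo_group
begin

text \<open>Formulas of arithmetic are translated by recursion. Terms are translated through their
  graphs, with additional variables for representatives of the values of subterms, because sum and
  product are given by predicates and not by terms of the group language.\<close>

lemma interprets_arithI:
  fixes N :: "'a set" and f :: "'a \<Rightarrow> nat"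
  assumes N: "N \<subseteq> G" and surj: "f ` N = UNIV"
    and fo_N: "\<And>X g. finite X \<Longrightarrow> term_fun X g \<Longrightarrow> fo_pred X (\<lambda>v. g v \<in> N)"
    and fo_E: "\<And>X g h. finite X \<Longrightarrow> term_fun X g \<Longrightarrow> term_fun X h \<Longrightarrow> fo_pred X (\<lambda>v. E (g v) (h v))"
    and fo_S: "\<And>X g h k. finite X \<Longrightarrow> term_fun X g \<Longrightarrow> term_fun X h \<Longrightarrow> term_fun X k \<Longrightarrow>
      fo_pred X (\<lambda>v. S (g v) (h v) (k v))"
    and fo_M: "\<And>X g h k. finite X \<Longrightarrow> term_fun X g \<Longrightarrow> term_fun X h \<Longrightarrow> term_fun X k \<Longrightarrow>
      fo_pred X (\<lambda>v. M (g v) (h v) (k v))"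
    and E: "\<And>x y. x \<in> N \<Longrightarrow> y \<in> N \<Longrightarrow> E x y \<longleftrightarrow> f x = f y"
    and S: "\<And>x y z. x \<in> N \<Longrightarrow> y \<in> N \<Longrightarrow> z \<in> N \<Longrightarrow> S x y z \<longleftrightarrow> f x + f y = f z"
    and M: "\<And>x y z. x \<in> N \<Longrightarrow> y \<in> N \<Longrightarrow> z \<in> N \<Longrightarrow> M x y z \<longleftrightarrow> f x * f y = f z"
  shows "interprets_arith G m i e"
proof -
  have ex_N: "\<exists>a\<in>N. f a = n" for n using surj by (metis UNIV_I imageE)
  \<comment> \<open>This is the induction step for both term constructors: \<open>c\<close> is the
    constructor, \<open>opn\<close> its operation on numbers, and \<open>R\<close> the predicate
    that defines the graph of \<open>opn\<close> on representatives.\<close>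
  have op: "\<exists>P. fo_pred (insert n (atvars (c s t))) P \<and>
      (\<forall>v. range v \<subseteq> G \<and> v ` insert n (atvars (c s t)) \<subseteq> N \<longrightarrow> P v = (f (v n) = ateval (f \<circ> v) (c s t)))"
    if vars: "atvars (c s t) = atvars s \<union> atvars t"
      and ev: "\<And>v. ateval v (c s t) = opn (ateval v s) (ateval v t)"
      and fo_R: "\<And>X g h k. finite X \<Longrightarrow> term_fun X g \<Longrightarrow> term_fun X h \<Longrightarrow> term_fun X k \<Longrightarrow>
        fo_pred X (\<lambda>v. R (g v) (h v) (k v))"
      and R: "\<And>x y z. x \<in> N \<Longrightarrow> y \<in> N \<Longrightarrow> z \<in> N \<Longrightarrow> R x y z \<longleftrightarrow> opn (f x) (f y) = f z"
      and IHs: "\<And>n. n \<notin> atvars s \<Longrightarrow> \<exists>P. fo_pred (insert n (atvars s)) P \<and>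
        (\<forall>v. range v \<subseteq> G \<and> v ` insert n (atvars s) \<subseteq> N \<longrightarrow> P v = (f (v n) = ateval (f \<circ> v) s))"
      and IHt: "\<And>n. n \<notin> atvars t \<Longrightarrow> \<exists>P. fo_pred (insert n (atvars t)) P \<and>
        (\<forall>v. range v \<subseteq> G \<and> v ` insert n (atvars t) \<subseteq> N \<longrightarrow> P v = (f (v n) = ateval (f \<circ> v) t))"
    for c :: "aterm \<Rightarrow> aterm \<Rightarrow> aterm" and opn :: "nat \<Rightarrow> nat \<Rightarrow> nat" and R s t n
  proof -
    let ?X = "insert n (atvars s \<union> atvars t)"
    have fin: "finite ?X" by (simp add: finite_atvars)
    \<comment> \<open>The fresh variables \<open>p\<close> and \<open>q\<close> hold representatives
      of the values of \<open>s\<close> and \<open>t\<close>.\<close>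
    obtain p where p: "p \<notin> ?X" using fin ex_new_if_finite infinite_UNIV_nat by blast
    obtain q where q: "q \<notin> insert p ?X"
      using fin ex_new_if_finite infinite_UNIV_nat by (metis finite_insert)
    obtain P where P: "fo_pred (insert p (atvars s)) P"
      "\<And>v. range v \<subseteq> G \<Longrightarrow> v ` insert p (atvars s) \<subseteq> N \<Longrightarrow> P v = (f (v p) = ateval (f \<circ> v) s)"
      using IHs[of p] p by auto
    obtain Q where Q: "fo_pred (insert q (atvars t)) Q"
      "\<And>v. range v \<subseteq> G \<Longrightarrow> v ` insert q (atvars t) \<subseteq> N \<Longrightarrow> Q v = (f (v q) = ateval (f \<circ> v) t)"
      using IHt[of q] q by auto
    let ?Z = "insert q (insert p ?X)"
    define W where "W v \<longleftrightarrow> P v \<and> Q v \<and> v p \<in> N \<and> v q \<in> N \<and> R (v p) (v q) (v n)" for v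
    have "fo_pred ?Z W"
      unfolding W_def
      by (intro fo_pred_and fo_N fo_R fo_pred_mono[OF P(1)] fo_pred_mono[OF Q(1)] term_fun_var)
        (use fin in auto)
    then have fo: "fo_pred ?X (\<lambda>v. \<exists>a\<in>G. \<exists>b\<in>G. W (v(p := a, q := b)))"
      using fo_pred_ex_upd[OF fo_pred_ex_upd] by blast
    have "(\<exists>a\<in>G. \<exists>b\<in>G. W (v(p := a, q := b))) = (f (v n) = opn (ateval (f \<circ> v) s) (ateval (f \<circ> v) t))"
      if v: "range v \<subseteq> G" "v ` ?X \<subseteq> N" for v
    proof -
      have "W (v(p := a, q := b)) \<longleftrightarrow> a \<in> N \<and> b \<in> N \<and> f a = ateval (f \<circ> v) s \<and>
          f b = ateval (f \<circ> v) t \<and> opn (f a) (f b) = f (v n)"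
        if ab: "a \<in> G" "b \<in> G" for a b
      proof (cases "a \<in> N \<and> b \<in> N")
        case True
        let ?v = "v(p := a, q := b)"
        have 1: "range ?v \<subseteq> G" using v ab by (auto simp: image_subset_iff)
        have 2: "?v ` insert p (atvars s) \<subseteq> N" "?v ` insert q (atvars t) \<subseteq> N"
          using True v(2) by (auto simp: image_subset_iff)
        have 3: "ateval (f \<circ> ?v) s = ateval (f \<circ> v) s" "ateval (f \<circ> ?v) t = ateval (f \<circ> v) t"
          by (rule ateval_cong; use p q in auto)+
        have 4: "?v p = a" "?v q = b" "?v n = v n" using p q by auto
        show ?thesis
          unfolding W_def P(2)[OF 1 2(1)] Q(2)[OF 1 2(2)] 3 4
          using R[of a b "v n"] True v(2) by auto
      next
        case False
        then show ?thesis using p q by (auto simp: W_def)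
      qed
      then have "(\<exists>a\<in>G. \<exists>b\<in>G. W (v(p := a, q := b))) \<longleftrightarrow>
          (\<exists>a\<in>G. \<exists>b\<in>G. a \<in> N \<and> b \<in> N \<and> f a = ateval (f \<circ> v) s \<and>
          f b = ateval (f \<circ> v) t \<and> opn (f a) (f b) = f (v n))" by simp
      also have "\<dots> \<longleftrightarrow> (f (v n) = opn (ateval (f \<circ> v) s) (ateval (f \<circ> v) t))"
        using ex_N[of "ateval (f \<circ> v) s"] ex_N[of "ateval (f \<circ> v) t"] N by (metis subsetD)
      finally show ?thesis .
    qed
    with fo show ?thesis unfolding ev vars by blast
  qed
  have tm: "\<exists>P. fo_pred (insert n (atvars s)) P \<and>
      (\<forall>v. range v \<subseteq> G \<and> v ` insert n (atvars s) \<subseteq> N \<longrightarrow> P v = (f (v n) = ateval (f \<circ> v) s))" for n s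
  proof (induction s arbitrary: n)
    case (AVar k)
    have "fo_pred {n, k} (\<lambda>v. E (v n) (v k))" by (intro fo_E term_fun_var) auto
    then show ?case using E by (intro exI[of _ "\<lambda>v. E (v n) (v k)"]) auto
  next
    case (APlus s t)
    show ?case
      by (rule op[where c = APlus and opn = "(+)" and R = S])
        (rule APlus.IH | (rule fo_S; assumption) | (subst S; simp) | simp)+
  next
    case (ATimes s t)
    show ?case
      by (rule op[where c = ATimes and opn = "(*)" and R = M])
        (rule ATimes.IH | (rule fo_M; assumption) | (subst M; simp) | simp)+
  qed
  have fm: "\<exists>P. fo_pred (afree \<phi>) P \<and>
      (\<forall>v. range v \<subseteq> G \<and> v ` afree \<phi> \<subseteq> N \<longrightarrow> P v = asat (f \<circ> v) \<phi>)" for \<phi>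
  proof (induction \<phi>)
    case (AEq s t)
    let ?X = "atvars s \<union> atvars t"
    have fin: "finite ?X" by (simp add: finite_atvars)
    \<comment> \<open>Two terms are equal when a single representative serves as the value of
      both.\<close>
    obtain p where p: "p \<notin> ?X" using fin ex_new_if_finite infinite_UNIV_nat by blast
    obtain P where P: "fo_pred (insert p (atvars s)) P"
      "\<And>v. range v \<subseteq> G \<Longrightarrow> v ` insert p (atvars s) \<subseteq> N \<Longrightarrow> P v = (f (v p) = ateval (f \<circ> v) s)"
      using tm[of p s] by auto
    obtain Q where Q: "fo_pred (insert p (atvars t)) Q"
      "\<And>v. range v \<subseteq> G \<Longrightarrow> v ` insert p (atvars t) \<subseteq> N \<Longrightarrow> Q v = (f (v p) = ateval (f \<circ> v) t)"
      using tm[of p t] by auto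
    define W where "W v \<longleftrightarrow> P v \<and> Q v \<and> v p \<in> N" for v
    have "fo_pred (insert p ?X) W"
      unfolding W_def
      by (intro fo_pred_and fo_N fo_pred_mono[OF P(1)] fo_pred_mono[OF Q(1)] term_fun_var)
        (use fin in auto)
    then have fo: "fo_pred ?X (\<lambda>v. \<exists>a\<in>G. W (v(p := a)))" by (rule fo_pred_ex_upd)
    have "(\<exists>a\<in>G. W (v(p := a))) = (ateval (f \<circ> v) s = ateval (f \<circ> v) t)"
      if v: "range v \<subseteq> G" "v ` ?X \<subseteq> N" for v
    proof -
      have "W (v(p := a)) \<longleftrightarrow> a \<in> N \<and> f a = ateval (f \<circ> v) s \<and> f a = ateval (f \<circ> v) t"
        if a: "a \<in> G" for a
      proof (cases "a \<in> N")
        case True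
        let ?v = "v(p := a)"
        have 1: "range ?v \<subseteq> G" using v a by (auto simp: image_subset_iff)
        have 2: "?v ` insert p (atvars s) \<subseteq> N" "?v ` insert p (atvars t) \<subseteq> N"
          using True v(2) by (auto simp: image_subset_iff)
        have 3: "ateval (f \<circ> ?v) s = ateval (f \<circ> v) s" "ateval (f \<circ> ?v) t = ateval (f \<circ> v) t"
          by (rule ateval_cong; use p in auto)+
        show ?thesis
          unfolding W_def P(2)[OF 1 2(1)] Q(2)[OF 1 2(2)] 3 using True by auto
      qed (auto simp: W_def)
      then have "(\<exists>a\<in>G. W (v(p := a))) \<longleftrightarrow>
          (\<exists>a\<in>G. a \<in> N \<and> f a = ateval (f \<circ> v) s \<and> f a = ateval (f \<circ> v) t)" by simp
      also have "\<dots> \<longleftrightarrow> (ateval (f \<circ> v) s = ateval (f \<circ> v) t)"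
        using ex_N[of "ateval (f \<circ> v) s"] N by auto
      finally show ?thesis .
    qed
    with fo show ?case unfolding afree.simps asat.simps by blast
  next
    case (ANot \<phi>)
    then obtain P where "fo_pred (afree \<phi>) P"
      "\<forall>v. range v \<subseteq> G \<and> v ` afree \<phi> \<subseteq> N \<longrightarrow> P v = asat (f \<circ> v) \<phi>" by blast
    then show ?case
      unfolding afree.simps asat.simps by (intro exI[of _ "\<lambda>v. \<not> P v"]) (blast intro: fo_pred_not)
  next
    case (AAnd \<phi> \<psi>)
    then obtain P Q where PQ: "fo_pred (afree \<phi>) P" "fo_pred (afree \<psi>) Q"
      "\<And>v. range v \<subseteq> G \<Longrightarrow> v ` afree \<phi> \<subseteq> N \<Longrightarrow> P v = asat (f \<circ> v) \<phi>"
      "\<And>v. range v \<subseteq> G \<Longrightarrow> v ` afree \<psi> \<subseteq> N \<Longrightarrow> Q v = asat (f \<circ> v) \<psi>" by blast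
    have "fo_pred (afree \<phi> \<union> afree \<psi>) (\<lambda>v. P v \<and> Q v)"
      by (intro fo_pred_and fo_pred_mono[OF PQ(1)] fo_pred_mono[OF PQ(2)]) auto
    moreover have "(P v \<and> Q v) = (asat (f \<circ> v) \<phi> \<and> asat (f \<circ> v) \<psi>)"
      if "range v \<subseteq> G" "v ` (afree \<phi> \<union> afree \<psi>) \<subseteq> N" for v
      using that PQ(3,4)[of v] by (simp add: image_Un)
    ultimately show ?case unfolding afree.simps asat.simps by blast
  next
    case (AEx n \<phi>)
    then obtain P where P: "fo_pred (afree \<phi>) P"
      "\<And>v. range v \<subseteq> G \<Longrightarrow> v ` afree \<phi> \<subseteq> N \<Longrightarrow> P v = asat (f \<circ> v) \<phi>" by blast
    have "fo_pred (insert n (afree \<phi> - {n})) (\<lambda>v. v n \<in> N \<and> P v)"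
      by (intro fo_pred_and fo_N fo_pred_mono[OF P(1)] term_fun_var) (auto simp: finite_afree)
    then have fo: "fo_pred (afree \<phi> - {n}) (\<lambda>v. \<exists>a\<in>G. (v(n := a)) n \<in> N \<and> P (v(n := a)))"
      by (rule fo_pred_ex_upd)
    have "(\<exists>a\<in>G. (v(n := a)) n \<in> N \<and> P (v(n := a))) = (\<exists>b. asat ((f \<circ> v)(n := b)) \<phi>)"
      if v: "range v \<subseteq> G" "v ` (afree \<phi> - {n}) \<subseteq> N" for v
    proof -
      have "P (v(n := a)) = asat ((f \<circ> v)(n := f a)) \<phi>" if a: "a \<in> N" for a
      proof -
        have "range (v(n := a)) \<subseteq> G" "v(n := a) ` afree \<phi> \<subseteq> N"
          using v a N by (auto simp: image_subset_iff)
        then show ?thesis by (simp add: P(2) fun_upd_comp)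
      qed
      moreover have "\<exists>a\<in>N. f a = b" for b by (rule ex_N)
      ultimately show ?thesis using N by (metis fun_upd_same subsetD)
    qed
    with fo show ?case unfolding afree.simps asat.simps by blast
  qed
  define D where "D = {[x] | x. x \<in> N}"
  define F where "F xs = f (hd xs)" for xs
  \<comment> \<open>The defining formula must also say that all coordinates are representatives: the
    translation is correct only for those, and the preimage consists of tuples from
    \<open>D\<close>.\<close>
  have fo_all: "fo_pred {..<k} (\<lambda>v. \<forall>j<l. v j \<in> N)" if "l \<le> k" for k l
    using that
  proof (induction l)
    case 0
    have "fo_pred {..<k} (\<lambda>v. e = e)" by (intro fo_pred_eq term_fun_one)
    then show ?case by simp
  next
    case (Suc l)
    then have "fo_pred {..<k} (\<lambda>v. v l \<in> N \<and> (\<forall>j<l. v j \<in> N))"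
      by (intro fo_pred_and fo_N term_fun_var) auto
    then show ?case by (rule fo_pred_cong) (auto simp: less_Suc_eq)
  qed
  have "gdefinable G m i e (1 * k) {concat ys | ys. length ys = k \<and> set ys \<subseteq> D \<and> map F ys \<in> T}"
    if T: "adefinable k T" for k T
  proof -
    obtain \<phi> where \<phi>: "afree \<phi> \<subseteq> {..<k}"
      "T = {xs. length xs = k \<and> (\<forall>v. (\<forall>j<k. v j = xs ! j) \<longrightarrow> asat v \<phi>)}"
      using T unfolding adefinable_def by blast
    obtain P where P: "fo_pred (afree \<phi>) P"
      "\<And>v. range v \<subseteq> G \<Longrightarrow> v ` afree \<phi> \<subseteq> N \<Longrightarrow> P v = asat (f \<circ> v) \<phi>" using fm[of \<phi>] by blast
    have "fo_pred {..<k} (\<lambda>v. (\<forall>j<k. v j \<in> N) \<and> P v)"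
      by (intro fo_pred_and fo_all fo_pred_mono[OF P(1)] \<phi>) auto
    then obtain \<psi> where \<psi>: "gfree \<psi> \<subseteq> {..<k}"
      "\<And>v. range v \<subseteq> G \<Longrightarrow> gsat G m i e v \<psi> \<longleftrightarrow> (\<forall>j<k. v j \<in> N) \<and> P v"
      unfolding fo_pred_def by blast
    have sat: "gsat G m i e v \<psi> \<longleftrightarrow> set xs \<subseteq> N \<and> map f xs \<in> T"
      if xs: "length xs = k" and v: "\<forall>j<k. v j = xs ! j" "range v \<subseteq> G" for xs v
    proof -
      have N_iff: "(\<forall>j<k. v j \<in> N) \<longleftrightarrow> set xs \<subseteq> N"
        using xs v by (auto simp: in_set_conv_nth subset_iff)
      have "P v \<longleftrightarrow> map f xs \<in> T" if "set xs \<subseteq> N"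
      proof -
        have "v ` afree \<phi> \<subseteq> N" using that N_iff \<phi>(1) by auto
        then have "P v = asat (f \<circ> v) \<phi>" by (intro P v)
        also have "\<dots> \<longleftrightarrow> (\<forall>w. (\<forall>j<k. w j = map f xs ! j) \<longrightarrow> asat w \<phi>)"
        proof
          assume sat: "asat (f \<circ> v) \<phi>"
          show "\<forall>w. (\<forall>j<k. w j = map f xs ! j) \<longrightarrow> asat w \<phi>"
          proof (intro allI impI)
            fix w assume "\<forall>j<k. w j = map f xs ! j"
            then have "asat w \<phi> = asat (f \<circ> v) \<phi>" using \<phi>(1) xs v by (intro asat_cong) auto
            then show "asat w \<phi>" using sat by simp
          qed
        qed (use xs v in auto)
        also have "\<dots> \<longleftrightarrow> map f xs \<in> T" using xs by (simp add: \<phi>(2))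
        finally show ?thesis .
      qed
      then show ?thesis using \<psi>(2)[OF v(2)] N_iff by blast
    qed
    have "{concat ys | ys. length ys = k \<and> set ys \<subseteq> D \<and> map F ys \<in> T} =
        {xs. length xs = k \<and> set xs \<subseteq> N \<and> map f xs \<in> T}" (is "?L = ?R")
    proof
      show "?L \<subseteq> ?R"
      proof
        fix xs assume "xs \<in> ?L"
        then obtain ys where ys: "xs = concat ys" "length ys = k" "set ys \<subseteq> D" "map F ys \<in> T" by blast
        have "\<And>y. y \<in> set ys \<Longrightarrow> y = [hd y]" using ys(3) by (auto simp: D_def)
        then have "ys = map (\<lambda>y. [hd y]) ys" by (intro map_idI[symmetric]) metis
        then have "xs = concat (map (\<lambda>y. [hd y]) ys)" using ys(1) by simp
        then have xs: "xs = map hd ys" by simp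
        have "map f xs = map F ys" by (simp add: xs F_def)
        then have "map f xs \<in> T" using ys(4) by metis
        moreover have "length xs = k" "set xs \<subseteq> N" using ys(2,3) by (auto simp: xs D_def)
        ultimately show "xs \<in> ?R" by blast
      qed
    next
      show "?R \<subseteq> ?L"
      proof
        fix xs assume xs: "xs \<in> ?R"
        have "map F (map (\<lambda>x. [x]) xs) = map f xs" by (simp add: F_def)
        then have "map F (map (\<lambda>x. [x]) xs) \<in> T" using xs by (metis (lifting) mem_Collect_eq)
        moreover have "set (map (\<lambda>x. [x]) xs) \<subseteq> D" using xs by (auto simp: D_def)
        ultimately have "xs = concat (map (\<lambda>x. [x]) xs) \<and> length (map (\<lambda>x. [x]) xs) = k \<and>
            set (map (\<lambda>x. [x]) xs) \<subseteq> D \<and> map F (map (\<lambda>x. [x]) xs) \<in> T"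
          using xs by simp
        then show "xs \<in> ?L" by blast
      qed
    qed
    also have "\<dots> = {xs. length xs = k \<and> set xs \<subseteq> G \<and>
              (\<forall>v. (\<forall>j<k. v j = xs ! j) \<and> range v \<subseteq> G \<longrightarrow> gsat G m i e v \<psi>)}"
    proof (rule Collect_cong, rule iffI)
      fix xs
      assume xs: "length xs = k \<and> set xs \<subseteq> G \<and>
        (\<forall>v. (\<forall>j<k. v j = xs ! j) \<and> range v \<subseteq> G \<longrightarrow> gsat G m i e v \<psi>)"
      then have xs1: "length xs = k" and xs2: "set xs \<subseteq> G"
        and xs3: "\<And>v. (\<forall>j<k. v j = xs ! j) \<Longrightarrow> range v \<subseteq> G \<Longrightarrow> gsat G m i e v \<psi>" by blast+
      \<comment> \<open>The tuple is extended to an assignment with values in \<open>G\<close>; the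
        default value beyond \<open>k\<close> is \<open>e\<close>.\<close>
      define v where "v j = (if j < k then xs ! j else e)" for j
      have "v j \<in> G" for j using xs1 subsetD[OF xs2 nth_mem, of j] by (simp add: v_def)
      then have "range v \<subseteq> G" by blast
      moreover have "\<forall>j<k. v j = xs ! j" by (simp add: v_def)
      ultimately have v: "\<forall>j<k. v j = xs ! j" "range v \<subseteq> G" by simp_all
      show "length xs = k \<and> set xs \<subseteq> N \<and> map f xs \<in> T"
        using sat[OF xs1 v] xs3[OF v] xs1 by simp
    next
      fix xs assume xs: "length xs = k \<and> set xs \<subseteq> N \<and> map f xs \<in> T"
      then have "gsat G m i e v \<psi>" if "(\<forall>j<k. v j = xs ! j) \<and> range v \<subseteq> G" for v
        using sat[of xs v] that by simp
      then show "length xs = k \<and> set xs \<subseteq> G \<and>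
        (\<forall>v. (\<forall>j<k. v j = xs ! j) \<and> range v \<subseteq> G \<longrightarrow> gsat G m i e v \<psi>)"
        using xs subset_trans[OF _ N] by simp
    qed
    finally show ?thesis unfolding gdefinable_def mult_1 using \<psi>(1) by blast
  qed
  moreover have "D \<subseteq> {xs. length xs = 1 \<and> set xs \<subseteq> G}" using N by (auto simp: D_def)
  moreover have "F ` D = UNIV"
  proof -
    have "F ` D = f ` N" by (force simp: D_def F_def)
    then show ?thesis using surj by simp
  qed
  ultimately show ?thesis unfolding interprets_arith_def by blast
qed

end

section \<open>Arithmetic from germs at two ends\<close>

text \<open>This isolates what the arithmetic uses about piecewise affine maps: two homomorphisms to
  the integers whose vanishing is definable, a supply of transitive elements with any exponents of
  opposite signs, and the fact that on the centralizer of such an element triviality at the first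
  end implies triviality at the second.\<close>

locale two_ended_group = fo_group G m i e
  for G :: "'a set" and m i e +
  fixes \<alpha> \<beta> :: "'a \<Rightarrow> int"
  assumes m_assoc: "x \<in> G \<Longrightarrow> y \<in> G \<Longrightarrow> z \<in> G \<Longrightarrow> m (m x y) z = m x (m y z)"
    and m_one: "x \<in> G \<Longrightarrow> m e x = x" "x \<in> G \<Longrightarrow> m x e = x"
    and m_inv: "x \<in> G \<Longrightarrow> m (i x) x = e" "x \<in> G \<Longrightarrow> m x (i x) = e"
    and hom_m [simp]: "x \<in> G \<Longrightarrow> y \<in> G \<Longrightarrow> \<alpha> (m x y) = \<alpha> x + \<alpha> y"
      "x \<in> G \<Longrightarrow> y \<in> G \<Longrightarrow> \<beta> (m x y) = \<beta> x + \<beta> y"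
    and small_iff: "x \<in> G \<Longrightarrow> small x \<longleftrightarrow> \<alpha> x = 0 \<and> \<beta> x = 0"
    and one_sided_iff: "x \<in> G \<Longrightarrow> one_sided x \<longleftrightarrow> \<alpha> x = 0 \<or> \<beta> x = 0"
    and transitive_sign: "z \<in> G \<Longrightarrow> transitive z \<Longrightarrow> \<alpha> z * \<beta> z < 0"
    and transitive_ex: "p * q < 0 \<Longrightarrow> \<exists>z\<in>G. transitive z \<and> \<alpha> z = p \<and> \<beta> z = q"
    and centralizer_germ:
      "z \<in> G \<Longrightarrow> transitive z \<Longrightarrow> u \<in> G \<Longrightarrow> commute u z \<Longrightarrow> \<alpha> u = 0 \<Longrightarrow> \<beta> u = 0"
begin

lemma hom_one [simp]: "\<alpha> e = 0" "\<beta> e = 0"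
  using hom_m[of e e] m_one(1)[of e] by simp_all

lemma hom_inv [simp]: "x \<in> G \<Longrightarrow> \<alpha> (i x) = - \<alpha> x" "x \<in> G \<Longrightarrow> \<beta> (i x) = - \<beta> x"
  using hom_m[of x "i x"] m_inv(2)[of x] by simp_all

lemma commute_one: "z \<in> G \<Longrightarrow> commute e z"
  by (simp add: commute_def m_one)

lemma commute_m: "x \<in> G \<Longrightarrow> y \<in> G \<Longrightarrow> z \<in> G \<Longrightarrow> commute x z \<Longrightarrow> commute y z \<Longrightarrow> commute (m x y) z"
  unfolding commute_def by (metis m_assoc)

lemma commute_i:
  assumes "x \<in> G" "z \<in> G" "commute x z" shows "commute (i x) z"
proof -
  have "m (i x) z = m (m (i x) z) (m x (i x))" using assms by (simp add: m_inv m_one)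
  also have "\<dots> = m (i x) (m (m z x) (i x))" using assms by (simp add: m_assoc)
  also have "\<dots> = m (i x) (m (m x z) (i x))" using assms by (simp add: commute_def)
  also have "\<dots> = m (m (i x) x) (m z (i x))" using assms by (simp add: m_assoc)
  also have "\<dots> = m z (i x)" using assms by (simp add: m_inv m_one)
  finally show ?thesis by (simp add: commute_def)
qed

lemma centralizer_scale:
  assumes "z \<in> G" "x \<in> G" "commute x z"
  shows "\<exists>y\<in>G. commute y z \<and> \<alpha> y = k * \<alpha> x \<and> \<beta> y = k * \<beta> x"
proof (induction k rule: int_induct[where k = 0])
  case base
  show ?case using commute_one[OF assms(1)] by (intro bexI[of _ e]) auto
next
  case (step1 k)
  then obtain y where "y \<in> G" "commute y z" "\<alpha> y = k * \<alpha> x" "\<beta> y = k * \<beta> x" by blast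
  then show ?case using assms
    by (intro bexI[of _ "m y x"]) (auto simp: algebra_simps intro: commute_m)
next
  case (step2 k)
  then obtain y where "y \<in> G" "commute y z" "\<alpha> y = k * \<alpha> x" "\<beta> y = k * \<beta> x" by blast
  then show ?case using assms
    by (intro bexI[of _ "m y (i x)"]) (auto simp: algebra_simps intro: commute_m commute_i)
qed

text \<open>A product of powers of \<open>u\<close> and \<open>z\<close> that cancels at the first
  end still lies in the centralizer of \<open>z\<close>, hence cancels at the second end as
  well.\<close>

lemma centralizer_proportional:
  assumes "z \<in> G" "transitive z" "u \<in> G" "commute u z"
  shows "\<alpha> u * \<beta> z = \<beta> u * \<alpha> z"
proof -
  \<comment> \<open>\<open>x\<close> has the exponents of the power of \<open>u\<close> by
    \<open>\<alpha> z\<close>, and \<open>y\<close> below those of the power of \<open>z\<close> by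
    \<open>- \<alpha> u\<close>.\<close>
  obtain x where x: "x \<in> G" "commute x z" "\<alpha> x = \<alpha> z * \<alpha> u" "\<beta> x = \<alpha> z * \<beta> u"
    using centralizer_scale[OF assms(1,3,4)] by blast
  have "commute z z" by (simp add: commute_def)
  then obtain y where y: "y \<in> G" "commute y z" "\<alpha> y = - \<alpha> u * \<alpha> z" "\<beta> y = - \<alpha> u * \<beta> z"
    using centralizer_scale[OF assms(1,1)] by blast
  have "\<beta> (m x y) = 0"
    by (rule centralizer_germ[OF assms(1,2)]) (use x y assms in \<open>auto intro: commute_m\<close>)
  then show ?thesis using x y by (simp add: algebra_simps)
qed

text \<open>A transitive \<open>w\<close> has opposite signs at its two ends, and so has every
  nontrivial \<open>x\<close> or \<open>y\<close> considered here. Agreement with \<open>w\<close>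
  at one end, no matter which, therefore fixes the orientation. For the converse, \<open>w\<close>
  takes its first exponent from \<open>x\<close> and its second from \<open>y\<close>.\<close>

lemma same_sign_iff:
  assumes "x \<in> G" "y \<in> G" "\<alpha> x * \<beta> x < 0 \<or> \<alpha> x = 0 \<and> \<beta> x = 0" "\<alpha> y * \<beta> y < 0 \<or> \<alpha> y = 0 \<and> \<beta> y = 0"
  shows "same_sign x y \<longleftrightarrow> \<alpha> x * \<alpha> y > 0"
proof
  assume "same_sign x y"
  then obtain w where w: "w \<in> G" "transitive w" "one_sided (m (i w) x)" "one_sided (m (i w) y)"
    unfolding same_sign_def by blast
  have "\<alpha> w * \<beta> w < 0" by (rule transitive_sign[OF w(1,2)])
  moreover have "\<alpha> x = \<alpha> w \<or> \<beta> x = \<beta> w" "\<alpha> y = \<alpha> w \<or> \<beta> y = \<beta> w"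
    using w assms by (auto simp: one_sided_iff)
  ultimately show "\<alpha> x * \<alpha> y > 0" using assms(3,4)
    by (auto simp: mult_less_0_iff zero_less_mult_iff)
next
  assume pos: "\<alpha> x * \<alpha> y > 0"
  then have "\<alpha> x * \<beta> y < 0" using assms(3,4)
    by (auto simp: mult_less_0_iff zero_less_mult_iff)
  then obtain w where "w \<in> G" "transitive w" "\<alpha> w = \<alpha> x" "\<beta> w = \<beta> y" using transitive_ex by blast
  then show "same_sign x y" unfolding same_sign_def
    using assms by (intro bexI[of _ w]) (auto simp: one_sided_iff)
qed

lemma unit_iff:
  assumes "z \<in> G"
  shows "unit z \<longleftrightarrow> transitive z \<and> \<bar>\<alpha> z\<bar> = 1 \<and> \<bar>\<beta> z\<bar> = 1"
proof
  assume u: "unit z"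
  then have t: "transitive z" by (simp add: unit_def)
  then have sg: "\<alpha> z * \<beta> z < 0" using transitive_sign assms by blast
  have False if "\<not> (\<bar>\<alpha> z\<bar> = 1 \<and> \<bar>\<beta> z\<bar> = 1)"
  proof -
    \<comment> \<open>An exponent other than \<open>1\<close> and \<open>-1\<close> is split into
      its sign and the rest. At the other end any exponents of the right sign will do, because
      \<open>one_sided\<close> asks for agreement at one end only.\<close>
    obtain p q p' q' where pq: "p * q < 0" "p' * q' < 0" "p * \<alpha> z > 0" "p' * \<alpha> z > 0"
      "p + p' = \<alpha> z \<or> q + q' = \<beta> z"
    proof (cases "\<bar>\<alpha> z\<bar> = 1")
      case False
      show ?thesis
        by (rule that[of "sgn (\<alpha> z)" "- sgn (\<alpha> z)" "\<alpha> z - sgn (\<alpha> z)" "- sgn (\<alpha> z)"])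
          (use sg False in \<open>auto simp: sgn_if mult_less_0_iff zero_less_mult_iff split: if_splits\<close>)
    next
      case True
      with that sg have xi: "\<bar>\<beta> z\<bar> \<noteq> 1" using \<open>\<not> (\<bar>\<alpha> z\<bar> = 1 \<and> \<bar>\<beta> z\<bar> = 1)\<close> by blast
      show ?thesis
        by (rule that[of "\<alpha> z" "sgn (\<beta> z)" "\<alpha> z" "\<beta> z - sgn (\<beta> z)"])
          (use sg xi in \<open>auto simp: sgn_if mult_less_0_iff zero_less_mult_iff split: if_splits\<close>)
    qed
    obtain a where a: "a \<in> G" "transitive a" "\<alpha> a = p" "\<beta> a = q" using transitive_ex pq(1) by blast
    obtain b where b: "b \<in> G" "transitive b" "\<alpha> b = p'" "\<beta> b = q'" using transitive_ex pq(2) by blast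
    have "same_sign a z" "same_sign b z" using a b pq sg assms by (simp_all add: same_sign_iff)
    moreover have "one_sided (m (i z) (m a b))" using a b pq assms by (auto simp: one_sided_iff)
    ultimately show False using u a b unfolding unit_def by blast
  qed
  then show "transitive z \<and> \<bar>\<alpha> z\<bar> = 1 \<and> \<bar>\<beta> z\<bar> = 1" using t by blast
next
  assume z: "transitive z \<and> \<bar>\<alpha> z\<bar> = 1 \<and> \<bar>\<beta> z\<bar> = 1"
  then have sg: "\<alpha> z * \<beta> z < 0" using transitive_sign assms by blast
  have False if ab: "a \<in> G" "b \<in> G" "transitive a" "transitive b" "same_sign a z" "same_sign b z"
    "one_sided (m (i z) (m a b))" for a b
  proof -
    have s: "\<alpha> a * \<beta> a < 0" "\<alpha> b * \<beta> b < 0" using transitive_sign ab by blast+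
    then have "\<alpha> a * \<alpha> z > 0" "\<alpha> b * \<alpha> z > 0" using ab sg assms same_sign_iff by blast+
    moreover have "\<alpha> a + \<alpha> b = \<alpha> z \<or> \<beta> a + \<beta> b = \<beta> z"
      using ab assms by (auto simp: one_sided_iff)
    ultimately show False using s sg z
      by (auto simp: mult_less_0_iff zero_less_mult_iff abs_if split: if_splits)
  qed
  then show "unit z" unfolding unit_def using z by blast
qed

text \<open>The exponents of \<open>x\<close> are proportional to those of a unit, which are
  \<open>1\<close> and \<open>-1\<close> in some order.\<close>

lemma num_germs:
  assumes "x \<in> G" "num x" shows "\<beta> x = - \<alpha> x"
proof -
  obtain t where t: "t \<in> G" "unit t" "commute x t" using assms(2) unfolding num_def by blast
  then have "transitive t" "\<bar>\<alpha> t\<bar> = 1" "\<bar>\<beta> t\<bar> = 1" "\<alpha> t * \<beta> t < 0"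
    by (auto simp: unit_iff transitive_sign)
  moreover have "\<alpha> x * \<beta> t = \<beta> x * \<alpha> t" using centralizer_proportional t assms calculation(1) by blast
  ultimately show ?thesis by (auto simp: abs_if split: if_splits)
qed

lemma num_ex: "\<exists>x\<in>G. num x \<and> \<alpha> x = k"
proof -
  obtain t where t: "t \<in> G" "transitive t" "\<alpha> t = 1" "\<beta> t = -1"
    using transitive_ex[of 1 "-1"] by auto
  then have "unit t" by (simp add: unit_iff)
  moreover obtain x where "x \<in> G" "commute x t" "\<alpha> x = k * \<alpha> t"
    using centralizer_scale[of t t k] t by (auto simp: commute_def)
  ultimately show ?thesis unfolding num_def using t by auto
qed

lemma num_eq_iff:
  assumes "x \<in> G" "y \<in> G" "\<beta> x = - \<alpha> x" "\<beta> y = - \<alpha> y"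
  shows "num_eq x y \<longleftrightarrow> \<bar>\<alpha> x\<bar> = \<bar>\<alpha> y\<bar>"
proof -
  have "num_eq x y \<longleftrightarrow> \<alpha> x + \<alpha> y = 0 \<or> \<alpha> x - \<alpha> y = 0"
    using assms by (auto simp: num_eq_def small_iff)
  then show ?thesis by arith
qed

lemma num_add_iff:
  assumes "x \<in> G" "y \<in> G" "z \<in> G" "\<beta> x = - \<alpha> x" "\<beta> y = - \<alpha> y" "\<beta> z = - \<alpha> z"
  shows "num_add x y z \<longleftrightarrow> \<bar>\<alpha> x\<bar> + \<bar>\<alpha> y\<bar> = \<bar>\<alpha> z\<bar>"
proof -
  \<comment> \<open>Elements with \<beta> = - \<alpha> meet the sign hypothesis of
    \<open>same_sign_iff\<close>, including the trivial ones.\<close>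
  have neg: "k * - k < 0 \<or> k = 0 \<and> - k = 0" for k :: int
    by (auto simp: mult_less_0_iff zero_less_mult_iff)
  have s: "same_sign x y \<longleftrightarrow> \<alpha> x * \<alpha> y > 0" "same_sign x (i y) \<longleftrightarrow> \<alpha> x * \<alpha> (i y) > 0"
    by (rule same_sign_iff; use assms neg[of "\<alpha> x"] neg[of "\<alpha> y"] in simp)+
  have q: "num_eq y z \<longleftrightarrow> \<bar>\<alpha> y\<bar> = \<bar>\<alpha> z\<bar>" "num_eq x z \<longleftrightarrow> \<bar>\<alpha> x\<bar> = \<bar>\<alpha> z\<bar>"
    "num_eq (m x y) z \<longleftrightarrow> \<bar>\<alpha> (m x y)\<bar> = \<bar>\<alpha> z\<bar>" "num_eq (m x (i y)) z \<longleftrightarrow> \<bar>\<alpha> (m x (i y))\<bar> = \<bar>\<alpha> z\<bar>"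
    by (rule num_eq_iff; use assms in simp)+
  have small: "small x \<longleftrightarrow> \<alpha> x = 0" "small y \<longleftrightarrow> \<alpha> y = 0"
    and hom: "\<alpha> (m x y) = \<alpha> x + \<alpha> y" "\<alpha> (m x (i y)) = \<alpha> x - \<alpha> y" "\<alpha> (i y) = - \<alpha> y"
    using assms by (simp_all add: small_iff)
  have cases: "a = 0 \<and> \<bar>b\<bar> = n \<or> b = 0 \<and> \<bar>a\<bar> = n \<or> (0 < a \<and> 0 < b \<or> a < 0 \<and> b < 0) \<and> \<bar>a + b\<bar> = n \<or>
      (0 < a \<and> 0 < - b \<or> a < 0 \<and> - b < 0) \<and> \<bar>a - b\<bar> = n \<longleftrightarrow> \<bar>a\<bar> + \<bar>b\<bar> = n" for a b n :: int
    by (cases a "0::int" rule: linorder_cases; cases b "0::int" rule: linorder_cases) auto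
  show ?thesis
    unfolding num_add_def s q small hom zero_less_mult_iff by (rule cases)
qed

lemma agree_off_iff:
  assumes "d \<in> G" "x \<in> G" "y \<in> G"
  shows "\<alpha> d \<noteq> 0 \<Longrightarrow> \<beta> d = 0 \<Longrightarrow> agree_off d x y \<longleftrightarrow> \<beta> x = \<beta> y"
    and "\<alpha> d = 0 \<Longrightarrow> \<beta> d \<noteq> 0 \<Longrightarrow> agree_off d x y \<longleftrightarrow> \<alpha> x = \<alpha> y"
  using assms by (auto simp: agree_off_def one_sided_iff)

text \<open>Proportionality of \<open>u\<close> and \<open>z\<close> is used in absolute values: one
  exponent of \<open>z\<close> has absolute value \<open>1\<close>, the other is that of
  \<open>y\<close>, and the exponents of \<open>u\<close> at the same ends are, up to sign, those of
  \<open>w\<close> and \<open>x\<close>, crosswise.\<close>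

lemma num_mult_iff:
  assumes "x \<in> G" "y \<in> G" "w \<in> G" "\<beta> x = - \<alpha> x" "\<beta> y = - \<alpha> y" "\<beta> w = - \<alpha> w"
  shows "num_mult x y w \<longleftrightarrow> \<bar>\<alpha> x\<bar> * \<bar>\<alpha> y\<bar> = \<bar>\<alpha> w\<bar>"
proof
  assume "num_mult x y w"
  then consider "small y" "small w"
    | c d t z u where "c \<in> G" "d \<in> G" "t \<in> G" "z \<in> G" "u \<in> G" "one_sided c" "one_sided d"
      "\<not> one_sided (m c d)" "unit t" "transitive z" "commute u z" "agree_off c z t"
      "agree_off d z y" "agree_off c u x" "agree_off d u w \<or> agree_off d u (i w)"
    unfolding num_mult_def by blast
  then show "\<bar>\<alpha> x\<bar> * \<bar>\<alpha> y\<bar> = \<bar>\<alpha> w\<bar>"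
  proof cases
    case 1
    then show ?thesis using assms by (simp add: small_iff)
  next
    case 2
    have t: "\<bar>\<alpha> t\<bar> = 1" "\<bar>\<beta> t\<bar> = 1" using 2 by (simp_all add: unit_iff)
    have "\<alpha> u * \<beta> z = \<beta> u * \<alpha> z" by (rule centralizer_proportional) fact+
    then have uz: "\<bar>\<alpha> u\<bar> * \<bar>\<beta> z\<bar> = \<bar>\<beta> u\<bar> * \<bar>\<alpha> z\<bar>" by (metis abs_mult)
    \<comment> \<open>Each of \<open>c\<close> and \<open>d\<close> is trivial at some end and their
      product at none, so they mark different ends; which of them marks which end remains
      open.\<close>
    have "\<alpha> c \<noteq> 0 \<and> \<beta> c = 0 \<and> \<alpha> d = 0 \<and> \<beta> d \<noteq> 0 \<or> \<alpha> c = 0 \<and> \<beta> c \<noteq> 0 \<and> \<alpha> d \<noteq> 0 \<and> \<beta> d = 0"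
      using 2 by (auto simp: one_sided_iff)
    then show ?thesis
    proof (elim disjE conjE)
      assume cd: "\<alpha> c \<noteq> 0" "\<beta> c = 0" "\<alpha> d = 0" "\<beta> d \<noteq> 0"
      then have "\<beta> z = \<beta> t" "\<alpha> z = \<alpha> y" "\<beta> u = \<beta> x" "\<alpha> u = \<alpha> w \<or> \<alpha> u = - \<alpha> w"
        using 2 assms by (auto simp: agree_off_iff)
      then show ?thesis using uz t assms by auto
    next
      assume cd: "\<alpha> c = 0" "\<beta> c \<noteq> 0" "\<alpha> d \<noteq> 0" "\<beta> d = 0"
      then have "\<alpha> z = \<alpha> t" "\<beta> z = \<beta> y" "\<alpha> u = \<alpha> x" "\<beta> u = \<beta> w \<or> \<beta> u = - \<beta> w"
        using 2 assms by (auto simp: agree_off_iff)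
      then show ?thesis using uz t assms by auto
    qed
  qed
next
  assume eq: "\<bar>\<alpha> x\<bar> * \<bar>\<alpha> y\<bar> = \<bar>\<alpha> w\<bar>"
  show "num_mult x y w"
  proof (cases "\<alpha> y = 0")
    case True
    then show ?thesis using eq assms by (simp add: num_mult_def small_iff)
  next
    case False
    let ?s = "sgn (\<alpha> y)"
    obtain a where a: "a \<in> G" "\<alpha> a = 1" "\<beta> a = -1" using transitive_ex[of 1 "-1"] by auto
    obtain b where b: "b \<in> G" "\<alpha> b = 2" "\<beta> b = -1" using transitive_ex[of 2 "-1"] by auto
    obtain b' where b': "b' \<in> G" "\<alpha> b' = 1" "\<beta> b' = -2" using transitive_ex[of 1 "-2"] by auto
    \<comment> \<open>The quotient of two transitive elements that differ at a single end is
      concentrated at that end.\<close>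
    define c where "c = m b (i a)"
    define d where "d = m b' (i a)"
    have cd: "c \<in> G" "d \<in> G" "\<alpha> c = 1" "\<beta> c = 0" "\<alpha> d = 0" "\<beta> d = -1"
      using a b b' by (simp_all add: c_def d_def)
    have sgn_neg: "?s * - ?s < 0" "\<alpha> y * - ?s < 0" using False by (auto simp: sgn_if)
    \<comment> \<open>\<open>t\<close> is a unit with the orientation of \<open>y\<close>, and
      \<open>z\<close> below joins the germ exponent of \<open>y\<close> at the first end to that of
      \<open>t\<close> at the second.\<close>
    obtain t where t: "t \<in> G" "transitive t" "\<alpha> t = ?s" "\<beta> t = - ?s"
      using transitive_ex[OF sgn_neg(1)] by blast
    then have "unit t" using False by (simp add: unit_iff sgn_if)
    obtain z where z: "z \<in> G" "transitive z" "\<alpha> z = \<alpha> y" "\<beta> z = - ?s"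
      using transitive_ex[OF sgn_neg(2)] by blast
    \<comment> \<open>The power of \<open>z\<close> is chosen to make \<beta> u equal to \<beta> x;
      the first exponent of \<open>u\<close> is then \<alpha> x times the absolute value of \<alpha>
      y.\<close>
    obtain u where u: "u \<in> G" "commute u z" "\<alpha> u = (\<alpha> x * ?s) * \<alpha> z" "\<beta> u = (\<alpha> x * ?s) * \<beta> z"
      using centralizer_scale[of z z "\<alpha> x * ?s"] z by (auto simp: commute_def)
    have xi_u: "\<beta> u = \<beta> x" using u z assms False by (simp add: sgn_if)
    have "\<bar>\<alpha> u\<bar> = \<bar>\<alpha> w\<bar>" using u z eq False by (simp add: abs_mult)
    then have "\<alpha> u = \<alpha> w \<or> \<alpha> u = \<alpha> (i w)" using assms by (simp add: abs_eq_iff)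
    then have "agree_off d u w \<or> agree_off d u (i w)"
      using cd u assms by (simp add: agree_off_iff)
    moreover have "agree_off c z t" "agree_off d z y" "agree_off c u x"
      using cd u z t assms xi_u by (simp_all add: agree_off_iff)
    moreover have "one_sided c" "one_sided d" "\<not> one_sided (m c d)"
      using cd by (simp_all add: one_sided_iff)
    ultimately show ?thesis unfolding num_mult_def using cd t z u \<open>unit t\<close> by blast
  qed
qed

theorem interprets_arith: "interprets_arith G m i e"
proof (rule interprets_arithI[where N = "{x \<in> G. num x}" and f = "\<lambda>x. nat \<bar>\<alpha> x\<bar>"
      and E = num_eq and S = num_add and M = num_mult])
  show "(\<lambda>x. nat \<bar>\<alpha> x\<bar>) ` {x \<in> G. num x} = UNIV"
  proof (rule equalityI, simp, rule subsetI)
    fix n :: nat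
    obtain x where "x \<in> G" "num x" "\<alpha> x = int n" using num_ex by blast
    then show "n \<in> (\<lambda>x. nat \<bar>\<alpha> x\<bar>) ` {x \<in> G. num x}" by (intro image_eqI[of _ _ x]) auto
  qed
  show "fo_pred X (\<lambda>v. g v \<in> {x \<in> G. num x})" if "finite X" "term_fun X g" for X g
    by (rule fo_pred_cong[OF fo_pred_num[OF that]]) (use term_fun_closed[OF that(2)] in auto)
  show "num_eq x y \<longleftrightarrow> nat \<bar>\<alpha> x\<bar> = nat \<bar>\<alpha> y\<bar>"
    if "x \<in> {x \<in> G. num x}" "y \<in> {x \<in> G. num x}" for x y
    using that num_eq_iff[of x y] by (auto simp: num_germs)
  show "num_add x y z \<longleftrightarrow> nat \<bar>\<alpha> x\<bar> + nat \<bar>\<alpha> y\<bar> = nat \<bar>\<alpha> z\<bar>"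
    if "x \<in> {x \<in> G. num x}" "y \<in> {x \<in> G. num x}" "z \<in> {x \<in> G. num x}" for x y z
    using that num_add_iff[of x y z] by (auto simp: num_germs)
  show "num_mult x y z \<longleftrightarrow> nat \<bar>\<alpha> x\<bar> * nat \<bar>\<alpha> y\<bar> = nat \<bar>\<alpha> z\<bar>"
    if "x \<in> {x \<in> G. num x}" "y \<in> {x \<in> G. num x}" "z \<in> {x \<in> G. num x}" for x y z
    using that num_mult_iff[of x y z]
    by (auto simp: num_germs nat_mult_distrib[symmetric] eq_nat_nat_iff)
qed (auto intro: fo_pred_num_eq fo_pred_num_add fo_pred_num_mult)

end

section \<open>Piecewise linear homeomorphisms of an interval\<close>

text \<open>\<open>g\<close> is a generator of the slope group, taken above \<open>1\<close> so that
  the order of slopes is the order of their integer exponents.\<close>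

locale pl_data =
  fixes r g :: real and A :: "real set"
  assumes r_pos: "0 < r" and g_gt_1: "1 < g" and A_subgroup: "add_subgroup A" and r_in_A: "r \<in> A"
    and A_scale: "a \<in> A \<Longrightarrow> g powi k * a \<in> A"
begin

lemma A_zero [simp]: "0 \<in> A" and A_add: "a \<in> A \<Longrightarrow> b \<in> A \<Longrightarrow> a + b \<in> A"
  and A_neg: "a \<in> A \<Longrightarrow> - a \<in> A"
  using A_subgroup unfolding add_subgroup_def by auto

lemma A_diff: "a \<in> A \<Longrightarrow> b \<in> A \<Longrightarrow> a - b \<in> A"
  using A_add[OF _ A_neg, of a b] by simp

lemma g_powi_pos [simp]: "0 < g powi k"
  using g_gt_1 by simp

lemma g_powi_add: "g powi (k + l) = g powi k * g powi l"
  using g_gt_1 by (simp add: power_int_add)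

lemma g_powi_minus: "g powi (- k) * g powi k = 1"
  using g_powi_add[of "-k" k] by simp

lemma g_powi_inj [simp]: "g powi k = g powi l \<longleftrightarrow> k = l"
  using power_int_strict_increasing[of k l g] power_int_strict_increasing[of l k g] g_gt_1
  by (metis linorder_neqE order_less_irrefl)

text \<open>The products of \<open>r\<close> with negative powers of \<open>g\<close> stay in
  \<open>A\<close> and tend to \<open>0\<close>.\<close>

lemma A_small: assumes "0 < d" shows "\<exists>a\<in>A. 0 < a \<and> a < d"
proof -
  obtain n where "(1 / g) ^ n < d / r"
    using real_arch_pow_inv[of "d / r" "1 / g"] assms r_pos g_gt_1 by auto
  then have "g powi (- int n) * r < d"
    using r_pos by (simp add: power_int_minus power_one_over field_simps)
  then show ?thesis using A_scale[OF r_in_A, of "- int n"] r_pos by (intro bexI) auto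
qed

lemma A_mult_int: assumes "a \<in> A" shows "of_int k * a \<in> A"
proof (induction k rule: int_induct[where k = 0])
  case (step1 k)
  then show ?case using A_add[OF step1(2) assms] by (simp add: algebra_simps)
next
  case (step2 k)
  then show ?case using A_diff[OF step2(2) assms] by (simp add: algebra_simps)
qed simp

lemma A_dense: assumes "a < b" obtains p where "p \<in> A" "a < p" "p < b"
proof -
  obtain d where d: "d \<in> A" "0 < d" "d < b - a" using A_small[of "b - a"] assms by auto
  define k where "k = \<lfloor>a / d\<rfloor> + 1"
  have "a / d < of_int k" "of_int k \<le> a / d + 1" unfolding k_def by linarith+
  then have "a < of_int k * d" "of_int k * d \<le> a + d" using d(2) by (simp_all add: field_simps)
  then show thesis using that[of "of_int k * d"] A_mult_int[OF d(1)] d(3) by auto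
qed

text \<open>A set \<open>P\<close> of possible breakpoints may be enlarged freely, so the sets for
  several maps can be united without handling sorted lists. The intervals are closed, which builds
  in continuity at the points of \<open>P\<close>.\<close>

definition affine_off :: "(real \<Rightarrow> real) \<Rightarrow> real set \<Rightarrow> bool" where
  "affine_off x P \<longleftrightarrow> (\<forall>a b. a < b \<longrightarrow> P \<inter> {a<..<b} = {} \<longrightarrow>
     (\<exists>k::int. \<forall>t\<in>{a..b}. x t = x a + g powi k * (t - a)))"

text \<open>The maps are total on the line, so products and inverses are those of bijections of the
  reals. That breakpoints have images in \<open>A\<close> is derived in
  \<open>PL_mem_A\<close>.\<close>

definition PL :: "(real \<Rightarrow> real) set" where
  "PL = {x. strict_mono x \<and> surj x \<and> (\<forall>t. t \<notin> {0..<r} \<longrightarrow> x t = t) \<and>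
     (\<exists>P. finite P \<and> P \<subseteq> A \<and> affine_off x P)}"

lemma affine_offD:
  "affine_off x P \<Longrightarrow> a < b \<Longrightarrow> P \<inter> {a<..<b} = {} \<Longrightarrow>
    \<exists>k::int. \<forall>t\<in>{a..b}. x t = x a + g powi k * (t - a)"
  unfolding affine_off_def by simp

lemma PL_strict_mono: "x \<in> PL \<Longrightarrow> strict_mono x" and PL_surj: "x \<in> PL \<Longrightarrow> surj x"
  and PL_outside: "x \<in> PL \<Longrightarrow> t \<notin> {0..<r} \<Longrightarrow> x t = t"
  unfolding PL_def by auto

lemma PL_less [simp]: "x \<in> PL \<Longrightarrow> x s < x t \<longleftrightarrow> s < t"
  and PL_le [simp]: "x \<in> PL \<Longrightarrow> x s \<le> x t \<longleftrightarrow> s \<le> t"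
  and PL_eq [simp]: "x \<in> PL \<Longrightarrow> x s = x t \<longleftrightarrow> s = t"
  using PL_strict_mono strict_mono_less strict_mono_less_eq strict_mono_eq by blast+

lemma PL_inv [simp]: "x \<in> PL \<Longrightarrow> x (inv x t) = t" "x \<in> PL \<Longrightarrow> inv x (x t) = t"
  by (simp_all add: PL_surj surj_f_inv_f inv_f_f[OF strict_mono_imp_inj_on[OF PL_strict_mono]])

lemma PL_0 [simp]: assumes "x \<in> PL" shows "x 0 = 0"
proof -
  let ?s = "inv x 0"
  have "\<not> ?s < 0" using PL_outside[OF assms, of ?s] assms by auto
  moreover have "\<not> x 0 < 0"
  proof
    assume "x 0 < 0"
    then have "x (x 0) = x 0" using PL_outside[OF assms, of "x 0"] by simp
    then show False using assms \<open>x 0 < 0\<close> by simp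
  qed
  moreover have "x 0 \<le> 0" using calculation(1) assms PL_le[OF assms, of 0 ?s] by simp
  ultimately show ?thesis by linarith
qed

lemma PL_r [simp]: "x \<in> PL \<Longrightarrow> x r = r"
  by (simp add: PL_outside)

lemma PL_range: assumes "x \<in> PL"
  shows "x t < r \<longleftrightarrow> t < r" "0 < x t \<longleftrightarrow> 0 < t" "0 \<le> x t \<longleftrightarrow> 0 \<le> t" "r \<le> x t \<longleftrightarrow> r \<le> t"
  by (metis assms PL_less PL_le PL_0 PL_r)+

lemma PL_moved: "x \<in> PL \<Longrightarrow> x t \<noteq> t \<Longrightarrow> 0 < t \<and> t < r"
  using PL_outside[of x t] PL_0[of x] by (cases "t = 0") force+

text \<open>\<open>q\<close> is the last breakpoint before \<open>t\<close>; inserting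
  \<open>0\<close> guarantees that there is one.\<close>

lemma PL_pred_break:
  assumes "affine_off x P" "finite P" "0 < t"
  obtains q k where "q \<in> insert 0 P" "0 \<le> q" "q < t" "x t = x q + g powi k * (t - q)"
    "insert 0 P \<inter> {q<..<t} = {}"
proof -
  let ?Q = "insert 0 P \<inter> {0..<t}"
  have Q: "finite ?Q" "?Q \<noteq> {}" using assms by auto
  define q where "q = Max ?Q"
  have q: "q \<in> ?Q" unfolding q_def by (rule Max_in[OF Q])
  have "y \<le> q" if "y \<in> ?Q" for y unfolding q_def by (rule Max_ge[OF Q(1) that])
  then have e: "insert 0 P \<inter> {q<..<t} = {}" using q by fastforce
  then have "P \<inter> {q<..<t} = {}" by blast
  moreover have q': "q \<in> insert 0 P" "0 \<le> q" "q < t" using q by auto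
  ultimately obtain k :: int where "\<forall>s\<in>{q..t}. x s = x q + g powi k * (s - q)"
    using affine_offD[OF assms(1), of q t] by metis
  from bspec[OF this, of t] have "x t = x q + g powi k * (t - q)" using q'(3) by simp
  then show thesis by (rule that[OF q' _ e])
qed

text \<open>From the fixed point \<open>0\<close> onwards, membership passes from one breakpoint to
  the next because slopes preserve \<open>A\<close>; the induction counts the breakpoints below
  \<open>t\<close>. Solving the affine equation for \<open>t\<close> gives the converse.\<close>

lemma PL_mem_A: assumes "x \<in> PL" shows "x t \<in> A \<longleftrightarrow> t \<in> A"
proof -
  obtain P where P: "finite P" "P \<subseteq> A" "affine_off x P" using assms unfolding PL_def by blast
  have fwd: "x t \<in> A" if "t \<in> A" "0 \<le> t" for t
    using that
  proof (induction "card (insert 0 P \<inter> {0..<t})" arbitrary: t rule: less_induct)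
    case less
    show ?case
    proof (cases "t = 0")
      case False
      then obtain q k where q: "q \<in> insert 0 P" "0 \<le> q" "q < t" "x t = x q + g powi k * (t - q)"
        using PL_pred_break[OF P(3,1), of t] less.prems by (metis less_eq_real_def)
      have "insert 0 P \<inter> {0..<q} \<subset> insert 0 P \<inter> {0..<t}" using q(1-3) by fastforce
      then have "card (insert 0 P \<inter> {0..<q}) < card (insert 0 P \<inter> {0..<t})"
        using P(1) by (intro psubset_card_mono) auto
      moreover have qA: "q \<in> A" using q(1) P(2) by auto
      ultimately have "x q \<in> A" using less.hyps q(2) by blast
      then show ?thesis unfolding q(4) using A_add A_scale A_diff less.prems(1) qA by blast
    qed (use assms in simp)
  qed
  show ?thesis
  proof (cases "0 < t")
    case True
    then obtain q k where q: "q \<in> insert 0 P" "0 \<le> q" "q < t" "x t = x q + g powi k * (t - q)"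
      using PL_pred_break[OF P(3,1) True] by metis
    have qA: "q \<in> A" using q(1) P(2) by auto
    have "g powi (- k) * (x t - x q) = t - q"
      unfolding q(4) using g_powi_minus[of k] by (simp add: mult.assoc[symmetric])
    then have "t = q + g powi (- k) * (x t - x q)" by simp
    then have "t \<in> A" if "x t \<in> A" using A_add A_scale A_diff that qA fwd[OF qA q(2)] by metis
    then show ?thesis using fwd True by auto
  next
    case False
    then have "x t = t" using PL_outside[OF assms, of t] PL_0[OF assms] by (cases "t = 0") simp_all
    then show ?thesis by simp
  qed
qed

lemma PL_id: "id \<in> PL"
proof -
  have "affine_off id {}" unfolding affine_off_def by (auto intro!: exI[of _ "0::int"])
  then show ?thesis unfolding PL_def by (auto simp: strict_mono_def)
qed

lemma PL_comp: assumes x: "x \<in> PL" and y: "y \<in> PL" shows "y \<circ> x \<in> PL"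
proof -
  obtain P where P: "finite P" "P \<subseteq> A" "affine_off x P" using x unfolding PL_def by blast
  obtain Q where Q: "finite Q" "Q \<subseteq> A" "affine_off y Q" using y unfolding PL_def by blast
  \<comment> \<open>The composite can break where \<open>x\<close> breaks or where \<open>x\<close>
    reaches a breakpoint of \<open>y\<close>.\<close>
  let ?S = "P \<union> inv x ` Q"
  have "?S \<subseteq> A" using P(2) Q(2) PL_mem_A[OF x, of "inv x q" for q] x by auto
  moreover have "finite ?S" using P(1) Q(1) by simp
  moreover have "affine_off (y \<circ> x) ?S"
    unfolding affine_off_def
  proof (intro allI impI)
    fix a b :: real assume ab: "a < b" "?S \<inter> {a<..<b} = {}"
    have "P \<inter> {a<..<b} = {}" using ab(2) by blast
    then obtain k :: int where k: "\<forall>t\<in>{a..b}. x t = x a + g powi k * (t - a)"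
      using affine_offD[OF P(3) ab(1)] by metis
    have "Q \<inter> {x a<..<x b} = {}"
    proof (rule ccontr)
      assume "Q \<inter> {x a<..<x b} \<noteq> {}"
      then obtain q where q: "q \<in> Q" "x a < q" "q < x b" by auto
      then have "a < inv x q" "inv x q < b"
        using PL_less[OF x, of a "inv x q"] PL_less[OF x, of "inv x q" b] x by auto
      then show False using ab(2) q(1) by auto
    qed
    moreover have "x a < x b" using ab(1) x by simp
    ultimately obtain l :: int where l: "\<forall>t\<in>{x a..x b}. y t = y (x a) + g powi l * (t - x a)"
      using affine_offD[OF Q(3)] by metis
    have "(y \<circ> x) t = (y \<circ> x) a + g powi (l + k) * (t - a)" if t: "t \<in> {a..b}" for t
    proof -
      have "x t \<in> {x a..x b}" using t x by simp
      then have "y (x t) = y (x a) + g powi l * (x t - x a)" using l by blast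
      also have "x t - x a = g powi k * (t - a)" using bspec[OF k t] by linarith
      finally show ?thesis by (simp add: g_powi_add)
    qed
    then show "\<exists>k::int. \<forall>t\<in>{a..b}. (y \<circ> x) t = (y \<circ> x) a + g powi k * (t - a)" by blast
  qed
  moreover have "strict_mono (y \<circ> x)" "surj (y \<circ> x)"
    using x y comp_surj[OF PL_surj[OF x] PL_surj[OF y]] by (simp_all add: strict_mono_def)
  moreover have "(y \<circ> x) t = t" if "t \<notin> {0..<r}" for t
    using that PL_outside[OF x that] PL_outside[OF y that] by simp
  ultimately show ?thesis unfolding PL_def by blast
qed

lemma PL_inv_closed: assumes x: "x \<in> PL" shows "inv x \<in> PL"
proof -
  obtain P where P: "finite P" "P \<subseteq> A" "affine_off x P" using x unfolding PL_def by blast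
  have less: "inv x s < inv x t \<longleftrightarrow> s < t" for s t
    using PL_less[OF x, of "inv x s" "inv x t"] x by simp
  have "x ` P \<subseteq> A" using P(2) PL_mem_A[OF x] by auto
  moreover have "affine_off (inv x) (x ` P)"
    unfolding affine_off_def
  proof (intro allI impI)
    fix a b :: real assume ab: "a < b" "x ` P \<inter> {a<..<b} = {}"
    have "P \<inter> {inv x a<..<inv x b} = {}"
    proof (rule ccontr)
      assume "P \<inter> {inv x a<..<inv x b} \<noteq> {}"
      then obtain p where "p \<in> P" "inv x a < p" "p < inv x b" by auto
      then have "x p \<in> x ` P \<inter> {a<..<b}"
        using PL_less[OF x, of "inv x a" p] PL_less[OF x, of p "inv x b"] x by auto
      then show False using ab(2) by blast
    qed
    moreover have "inv x a < inv x b" using less ab(1) by simp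
    ultimately obtain k :: int
      where k: "\<forall>t\<in>{inv x a..inv x b}. x t = x (inv x a) + g powi k * (t - inv x a)"
      using affine_offD[OF P(3)] by metis
    have "inv x t = inv x a + g powi (- k) * (t - a)" if "t \<in> {a..b}" for t
    proof -
      have "inv x a \<le> inv x t" "inv x t \<le> inv x b" using that less by (auto simp: not_less[symmetric])
      then have "t - a = g powi k * (inv x t - inv x a)" using bspec[OF k, of "inv x t"] x by simp
      then have "g powi (- k) * (t - a) = inv x t - inv x a"
        using g_powi_minus[of k] by (simp add: mult.assoc[symmetric])
      then show ?thesis by simp
    qed
    then show "\<exists>k::int. \<forall>t\<in>{a..b}. inv x t = inv x a + g powi k * (t - a)" by blast
  qed
  moreover have "strict_mono (inv x)" using less by (simp add: strict_mono_def)
  moreover have "surj (inv x)" using x by (metis PL_inv(2) surjI)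
  moreover have "inv x t = t" if "t \<notin> {0..<r}" for t
    using PL_outside[OF x that] PL_inv(2)[OF x, of t] by simp
  ultimately show ?thesis unfolding PL_def using P(1) by blast
qed

section \<open>Identification of \<open>PL\<close> with the given group\<close>

lemma Fgroup_subset_PL: assumes x: "x \<in> Fgroup r {g powi k | k::int. True} A" shows "x \<in> PL"
proof -
  obtain y where out: "\<And>t. t \<notin> {0..<r} \<Longrightarrow> x t = t" and hom: "homeomorphism {0..<r} {0..<r} x y"
    and PLA: "PL_LA r {g powi k | k::int. True} A x"
    using x unfolding Fgroup_def by auto
  have img: "x ` {0..<r} = {0..<r}" and cont: "continuous_on {0..<r} x" and inj: "inj_on x {0..<r}"
    using hom unfolding homeomorphism_def by (auto intro: inj_on_inverseI)
  have "strict_mono_on {0..<r} x \<or> strict_antimono_on {0..<r} x"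
    using injective_eq_monotone_map[of "{0..<r}" x] cont inj by (simp add: is_interval_co)
  \<comment> \<open>A decreasing map of \<open>{0..<r}\<close> onto itself would take its greatest
    value at \<open>0\<close>, but this interval has no greatest element.\<close>
  moreover have "\<not> strict_antimono_on {0..<r} x"
  proof
    assume anti: "strict_antimono_on {0..<r} x"
    have "x 0 \<in> {0..<r}" using img r_pos by auto
    then have "(x 0 + r) / 2 \<in> {0..<r}" by auto
    then obtain t where t: "t \<in> {0..<r}" "x t = (x 0 + r) / 2" using img by (metis imageE)
    then have "x 0 < x t" using \<open>x 0 \<in> {0..<r}\<close> by auto
    moreover have "x t \<le> x 0"
      using monotone_onD[OF anti, of 0 t] t(1) r_pos by (cases "t = 0") auto
    ultimately show False by simp
  qed
  ultimately have mono_on: "strict_mono_on {0..<r} x" by blast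
  have mono: "strict_mono x"
  proof (rule strict_monoI)
    fix s t :: real assume "s < t"
    consider "s \<in> {0..<r}" "t \<in> {0..<r}" | "s \<notin> {0..<r}" "t \<in> {0..<r}" | "s \<in> {0..<r}" "t \<notin> {0..<r}"
      | "s \<notin> {0..<r}" "t \<notin> {0..<r}" by blast
    then show "x s < x t"
    proof cases
      case 1
      then show ?thesis using strict_mono_onD[OF mono_on] \<open>s < t\<close> by blast
    next
      case 2
      then have "s < 0" "x t \<in> {0..<r}" using \<open>s < t\<close> img by auto
      then show ?thesis using out[OF 2(1)] by auto
    next
      case 3
      then have "r \<le> t" "x s \<in> {0..<r}" using \<open>s < t\<close> img by auto
      then show ?thesis using out[OF 3(2)] by auto
    next
      case 4
      then show ?thesis using out \<open>s < t\<close> by simp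
    qed
  qed
  have surj: "surj x"
  proof (rule surjI[where f = "\<lambda>t. if t \<in> {0..<r} then y t else t"])
    fix t show "x (if t \<in> {0..<r} then y t else t) = t"
      using hom out unfolding homeomorphism_def by auto
  qed
  have "continuous_on UNIV x"
    by (rule continuous_onI_mono) (use surj mono in \<open>auto simp: strict_mono_less_eq\<close>)
  then have isCont: "isCont x t" for t by (simp add: continuous_on_eq_continuous_at)
  obtain p s where ps: "length p \<ge> 2" "length s = length p - 1" "p ! 0 = 0" "last p = r"
    "sorted_wrt (<) p" "set p \<subseteq> A" "set s \<subseteq> {g powi k | k::int. True}"
    and piece: "\<And>i t. i < length p - 1 \<Longrightarrow> p ! i \<le> t \<Longrightarrow> t < p ! Suc i \<Longrightarrow>
      x t = x (p ! i) + s ! i * (t - p ! i)"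
    using PLA unfolding PL_LA_def by (elim exE conjE) blast
  have p_ne: "p \<noteq> []" using ps(1) length_greater_0_conv[of p] by linarith
  have "affine_off x (set p)"
    unfolding affine_off_def
  proof (intro allI impI)
    fix a b :: real assume ab: "a < b" "set p \<inter> {a<..<b} = {}"
    have ends: "0 \<in> set p" "r \<in> set p"
      using p_ne ps(3,4) nth_mem[of 0 p] last_in_set[of p] by simp_all
    have x_r: "x r = r" using out by simp
    have x_0: "x 0 = 0"
    proof -
      obtain t where "t \<in> {0..<r}" "x t = 0" using img r_pos by (metis atLeastLessThan_iff imageE order_refl)
      moreover have "x 0 \<ge> 0" using img r_pos by auto
      ultimately show ?thesis using mono by (metis atLeastLessThan_iff order_antisym strict_mono_less_eq)
    qed
    \<comment> \<open>\<open>0\<close> and \<open>r\<close> are entries of \<open>p\<close>, so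
      neither lies strictly between \<open>a\<close> and \<open>b\<close>.\<close>
    consider "b \<le> 0" | "r \<le> a" | "0 \<le> a" "b \<le> r"
      using ab ends by fastforce
    then show "\<exists>k::int. \<forall>t\<in>{a..b}. x t = x a + g powi k * (t - a)"
    proof cases
      case 1
      have "x t = t" if "t \<in> {a..b}" for t using that 1 x_0 out by (cases "t = 0") auto
      then show ?thesis using ab(1) by (intro exI[of _ 0]) auto
    next
      case 2
      have "x t = t" if "t \<in> {a..b}" for t using that 2 out by auto
      then show ?thesis using ab(1) by (intro exI[of _ 0]) auto
    next
      case 3
      \<comment> \<open>The piece containing \<open>a\<close> starts at the last entry of
        \<open>p\<close> that does not exceed \<open>a\<close>.\<close>
      define i where "i = Max {i. i < length p \<and> p ! i \<le> a}"
      have fin: "finite {i. i < length p \<and> p ! i \<le> a}" by simp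
      have ne: "{i. i < length p \<and> p ! i \<le> a} \<noteq> {}"
        using ps(1,3) 3(1) by (auto intro!: exI[of _ 0])
      have i: "i < length p" "p ! i \<le> a" using Max_in[OF fin ne] unfolding i_def by auto
      have "i \<noteq> length p - 1"
        using i(2) ps(4) last_conv_nth[of p] p_ne 3(2) ab(1) by auto
      then have i': "Suc i < length p" using i(1) by linarith
      have "a < p ! Suc i"
      proof (rule ccontr)
        assume "\<not> a < p ! Suc i"
        then have "Suc i \<le> i" unfolding i_def using i' by (intro Max_ge[OF fin]) (auto simp: i_def)
        then show False by simp
      qed
      then have bp: "b \<le> p ! Suc i" using ab(2) nth_mem[OF i'] by (auto simp: not_le)
      have "s ! i \<in> set s" using i' ps(2) by simp
      then obtain k :: int where k: "s ! i = g powi k" using ps(7) by auto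
      have eq: "x t = x a + g powi k * (t - a)" if "a \<le> t" "t < b" for t
      proof -
        have "i < length p - 1" using i' by linarith
        then show ?thesis
          using piece[of i t] piece[of i a] i(2) that bp ab(1) by (simp add: k algebra_simps)
      qed
      \<comment> \<open>\<open>PL_LA\<close> describes each piece without its right end, so the
        value at \<open>b\<close> comes from continuity.\<close>
      have "x b = x a + g powi k * (b - a)"
      proof (rule tendsto_unique[of "at_left b"])
        show "(x \<longlongrightarrow> x b) (at_left b)"
          using isCont[of b] by (simp add: isCont_def filterlim_at_split)
        have "((\<lambda>t. x a + g powi k * (t - a)) \<longlongrightarrow> x a + g powi k * (b - a)) (at_left b)"
          by (intro tendsto_intros)
        moreover have "eventually (\<lambda>t. x a + g powi k * (t - a) = x t) (at_left b)"
          unfolding eventually_at_left_field using ab(1) eq[symmetric]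
          by (intro exI[of _ a]) simp
        ultimately show "(x \<longlongrightarrow> x a + g powi k * (b - a)) (at_left b)"
          by (rule Lim_transform_eventually)
      qed simp
      then have "\<forall>t\<in>{a..b}. x t = x a + g powi k * (t - a)"
        using eq by (metis atLeastAtMost_iff less_eq_real_def)
      then show ?thesis by blast
    qed
  qed
  then show ?thesis unfolding PL_def using mono surj out ps(6) by blast
qed

lemma PL_subset_Fgroup: assumes x: "x \<in> PL" shows "x \<in> Fgroup r {g powi k | k::int. True} A"
proof -
  obtain P where P: "finite P" "P \<subseteq> A" "affine_off x P" using x unfolding PL_def by blast
  have cont: "continuous_on UNIV y" if "y \<in> PL" for y
    by (rule continuous_onI_mono) (use that PL_surj in auto)
  have "homeomorphism {0..<r} {0..<r} x (inv x)"
    using cont[OF x] cont[OF PL_inv_closed[OF x]] x PL_inv_closed[OF x]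
    by (intro homeomorphismI) (auto simp: PL_range intro: continuous_on_subset)
  \<comment> \<open>To obtain the list demanded by \<open>PL_LA\<close>, the ends \<open>0\<close>
    and \<open>r\<close> are added and points outside the interval are dropped.\<close>
  define Q where "Q = insert 0 (insert r (P \<inter> {0..r}))"
  have Q: "finite Q" "Q \<subseteq> A" "Q \<subseteq> {0..r}" "0 \<in> Q" "r \<in> Q"
    using P r_in_A r_pos by (auto simp: Q_def)
  have offQ: "Q \<inter> {a<..<b} = {} \<Longrightarrow> 0 \<le> a \<Longrightarrow> b \<le> r \<Longrightarrow> P \<inter> {a<..<b} = {}" for a b
    by (auto simp: Q_def)
  define p where "p = sorted_list_of_set Q"
  have p: "set p = Q" "sorted_wrt (<) p"
    using Q(1) by (simp_all add: p_def strict_sorted_list_of_set)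
  have "card Q \<ge> 2" using card_mono[OF Q(1), of "{0, r}"] Q(4,5) r_pos by simp
  then have len: "length p \<ge> 2" by (simp add: p_def)
  then have p_ne: "p \<noteq> []" using length_greater_0_conv[of p] by linarith
  have nth_less: "p ! i < p ! j \<longleftrightarrow> i < j" if "i < length p" "j < length p" for i j
    using that sorted_wrt_nth_less[OF p(2)] by (metis linorder_neqE_nat order_less_asym order_less_irrefl)
  have p0: "p ! 0 = 0"
  proof -
    obtain j where j: "j < length p" "p ! j = 0" using Q(4) p(1) by (metis in_set_conv_nth)
    have "p ! 0 \<in> Q" unfolding p(1)[symmetric] by (rule nth_mem) (use len in linarith)
    then have "p ! 0 \<ge> 0" using Q(3) by auto
    then show ?thesis using nth_less[of 0 j] j p_ne by (cases "j = 0") auto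
  qed
  have pr: "last p = r"
  proof -
    obtain j where j: "j < length p" "p ! j = r" using Q(5) p(1) by (metis in_set_conv_nth)
    have "last p \<in> Q" unfolding p(1)[symmetric] by (rule last_in_set[OF p_ne])
    then have "last p \<le> r" using Q(3) by auto
    then show ?thesis using nth_less[of j "length p - 1"] j p_ne
      by (cases "j = length p - 1") (auto simp: last_conv_nth[OF p_ne])
  qed
  have "\<exists>k::int. \<forall>t\<in>{p ! i..p ! Suc i}. x t = x (p ! i) + g powi k * (t - p ! i)"
    if i: "i < length p - 1" for i
  proof -
    have lt: "p ! i < p ! Suc i" using nth_less[of i "Suc i"] i by simp
    have "Q \<inter> {p ! i<..<p ! Suc i} = {}"
    proof (rule ccontr)
      assume "Q \<inter> {p ! i<..<p ! Suc i} \<noteq> {}"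
      then obtain j where "j < length p" "p ! i < p ! j" "p ! j < p ! Suc i"
        unfolding p(1)[symmetric] by (auto simp: in_set_conv_nth)
      then show False using nth_less[of i j] nth_less[of j "Suc i"] i by auto
    qed
    moreover have "p ! i \<in> Q" "p ! Suc i \<in> Q" using i p(1) by auto
    ultimately have "P \<inter> {p ! i<..<p ! Suc i} = {}" using offQ Q(3) by fastforce
    then show ?thesis using P(3) lt unfolding affine_off_def by blast
  qed
  then obtain k :: "nat \<Rightarrow> int" where k: "\<And>i t. i < length p - 1 \<Longrightarrow> p ! i \<le> t \<Longrightarrow> t \<le> p ! Suc i \<Longrightarrow>
      x t = x (p ! i) + g powi k i * (t - p ! i)"
    by (metis atLeastAtMost_iff)
  have "PL_LA r {g powi k | k::int. True} A x"
    unfolding PL_LA_def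
  proof (rule exI[of _ p], rule exI[of _ "map (\<lambda>i. g powi k i) [0..<length p - 1]"],
      intro conjI allI impI)
    fix i assume i: "i < length p - 1"
    have "p ! i \<in> A" using i p(1) Q(2) by auto
    then show "x (p ! i) \<in> A" by (simp add: PL_mem_A[OF x])
    fix t assume "p ! i \<le> t \<and> t < p ! Suc i"
    then have "x t = x (p ! i) + g powi k i * (t - p ! i)" by (intro k i) auto
    then show "x t = x (p ! i) + map (\<lambda>i. g powi k i) [0..<length p - 1] ! i * (t - p ! i)"
      using i by (metis diff_zero length_upt nth_map nth_upt plus_nat.add_0)
  qed (use len p p0 pr Q in auto)
  then show ?thesis unfolding Fgroup_def
    using PL_outside[OF x] \<open>homeomorphism {0..<r} {0..<r} x (inv x)\<close> by blast
qed

lemma Fgroup_eq: "Fgroup r {g powi k | k::int. True} A = PL"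
  using Fgroup_subset_PL PL_subset_Fgroup by blast

lemma Finv_eq: assumes "x \<in> PL" shows "Finv r x = inv x"
proof
  fix t
  have inj: "inj_on x {0..<r}" using assms by (simp add: inj_on_def)
  show "Finv r x t = inv x t"
  proof (cases "t \<in> {0..<r}")
    case True
    then have "inv x t \<in> {0..<r}" using PL_range[OF PL_inv_closed[OF assms]] by auto
    then have "the_inv_into {0..<r} x t = inv x t"
      using the_inv_into_f_f[OF inj, of "inv x t"] assms by simp
    then show ?thesis using True by (simp add: Finv_def)
  next
    case False
    then show ?thesis using PL_outside[OF PL_inv_closed[OF assms]] by (auto simp: Finv_def)
  qed
qed

section \<open>Germs and centralizers\<close>

text \<open>The sign \<sigma> is \<open>1\<close> for the right germ at \<open>p\<close> and
  \<open>-1\<close> for the left one. On both sides a positive exponent means that points near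
  \<open>p\<close> move away from \<open>p\<close>.\<close>

definition germ :: "real \<Rightarrow> real \<Rightarrow> (real \<Rightarrow> real) \<Rightarrow> int \<Rightarrow> bool" where
  "germ p \<sigma> x k \<longleftrightarrow> (\<exists>\<epsilon>>0. \<forall>h\<in>{0..\<epsilon>}. x (p + \<sigma> * h) = p + \<sigma> * (g powi k * h))"

lemma germ_ex:
  assumes x: "x \<in> PL" and fixp: "x p = p" and \<sigma>: "\<sigma> = 1 \<or> \<sigma> = -1"
  shows "\<exists>k. germ p \<sigma> x k"
proof -
  obtain P where P: "finite P" "affine_off x P" using x unfolding PL_def by blast
  obtain d where d: "0 < d" "\<forall>q\<in>P. q \<noteq> p \<longrightarrow> d \<le> dist p q" using finite_set_avoid[OF P(1)] by blast
  show ?thesis using \<sigma>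
  proof
    assume s: "\<sigma> = 1"
    have "P \<inter> {p<..<p + d} = {}" using d(2) by (force simp: dist_real_def)
    then obtain k :: int where k: "\<forall>t\<in>{p..p + d}. x t = x p + g powi k * (t - p)"
      using affine_offD[OF P(2), of p "p + d"] d(1) by auto
    have "x (p + h) = p + g powi k * h" if "h \<in> {0..d}" for h
      using bspec[OF k, of "p + h"] that fixp by simp
    then have "germ p 1 x k" unfolding germ_def using d(1) by (intro exI[of _ d]) simp
    then show ?thesis using s by blast
  next
    assume s: "\<sigma> = -1"
    have "P \<inter> {p - d<..<p} = {}" using d(2) by (force simp: dist_real_def)
    then obtain k :: int where k: "\<forall>t\<in>{p - d..p}. x t = x (p - d) + g powi k * (t - (p - d))"
      using affine_offD[OF P(2), of "p - d" p] d(1) by auto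
    have "x (p - h) = p - g powi k * h" if "h \<in> {0..d}" for h
      using bspec[OF k, of "p - h"] bspec[OF k, of p] d(1) that fixp by (simp add: algebra_simps)
    then have "germ p (-1) x k" unfolding germ_def using d(1) by (intro exI[of _ d]) simp
    then show ?thesis using s by blast
  qed
qed

lemma germ_unique:
  assumes "germ p \<sigma> x k" "germ p \<sigma> x l" "\<sigma> = 1 \<or> \<sigma> = -1" shows "k = l"
proof -
  obtain a where a: "a > 0" "\<And>h. h \<in> {0..a} \<Longrightarrow> x (p + \<sigma> * h) = p + \<sigma> * (g powi k * h)"
    using assms(1) unfolding germ_def by blast
  obtain b where b: "b > 0" "\<And>h. h \<in> {0..b} \<Longrightarrow> x (p + \<sigma> * h) = p + \<sigma> * (g powi l * h)"
    using assms(2) unfolding germ_def by blast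
  have "min a b \<in> {0..a}" "min a b \<in> {0..b}" using a(1) b(1) by auto
  then have "p + \<sigma> * (g powi k * min a b) = p + \<sigma> * (g powi l * min a b)"
    using a(2)[of "min a b"] b(2)[of "min a b"] by metis
  moreover have "min a b \<noteq> 0" using a(1) b(1) by simp
  ultimately have "g powi k = g powi l" using assms(3)
    by (metis add_left_cancel mult_cancel_left mult_cancel_right zero_neq_neg_one zero_neq_one)
  then show ?thesis by simp
qed

lemma germ_comp:
  assumes "germ p \<sigma> x k" "germ p \<sigma> y l" shows "germ p \<sigma> (y \<circ> x) (k + l)"
proof -
  obtain a where a: "a > 0" "\<And>h. h \<in> {0..a} \<Longrightarrow> x (p + \<sigma> * h) = p + \<sigma> * (g powi k * h)"
    using assms(1) unfolding germ_def by blast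
  obtain b where b: "b > 0" "\<And>h. h \<in> {0..b} \<Longrightarrow> y (p + \<sigma> * h) = p + \<sigma> * (g powi l * h)"
    using assms(2) unfolding germ_def by blast
  \<comment> \<open>The neighbourhood is shrunk until \<open>x\<close> maps it into the one on which
    \<open>y\<close> is affine.\<close>
  let ?e = "min a (b / g powi k)"
  have "(y \<circ> x) (p + \<sigma> * h) = p + \<sigma> * (g powi (k + l) * h)" if h: "h \<in> {0..?e}" for h
  proof -
    have "0 \<le> h" "h * g powi k \<le> b" using h by (auto simp: pos_le_divide_eq)
    then have "g powi k * h \<in> {0..b}" by (simp add: mult.commute order_less_imp_le)
    then show ?thesis using a(2)[of h] b(2)[of "g powi k * h"] h by (simp add: g_powi_add ac_simps)
  qed
  moreover have "?e > 0" using a(1) b(1) by simp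
  ultimately show ?thesis unfolding germ_def by blast
qed

lemma germ_moves:
  assumes "germ p \<sigma> x k" "k \<noteq> 0" "\<sigma> = 1 \<or> \<sigma> = -1"
  shows "\<exists>\<epsilon>>0. \<forall>h. 0 < h \<and> h \<le> \<epsilon> \<longrightarrow> x (p + \<sigma> * h) \<noteq> p + \<sigma> * h"
proof -
  obtain a where a: "a > 0" "\<And>h. h \<in> {0..a} \<Longrightarrow> x (p + \<sigma> * h) = p + \<sigma> * (g powi k * h)"
    using assms(1) unfolding germ_def by blast
  have "g powi k \<noteq> 1" using g_powi_inj[of k 0] assms(2) by simp
  then have "x (p + \<sigma> * h) \<noteq> p + \<sigma> * h" if "0 < h \<and> h \<le> a" for h
    using a(2)[of h] that assms(3) by auto
  then show ?thesis using a(1) by blast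
qed

lemma germ_zero: "germ p \<sigma> x 0 \<longleftrightarrow> (\<exists>\<epsilon>>0. \<forall>h\<in>{0..\<epsilon>}. x (p + \<sigma> * h) = p + \<sigma> * h)"
  by (simp add: germ_def)

lemma germ_zero_right: "germ p 1 x 0 \<longleftrightarrow> (\<exists>\<epsilon>>0. \<forall>t\<in>{p..p + \<epsilon>}. x t = t)"
proof -
  have "(\<forall>h\<in>{0..\<epsilon>}. x (p + 1 * h) = p + 1 * h) \<longleftrightarrow> (\<forall>t\<in>{p..p + \<epsilon>}. x t = t)" for \<epsilon>
    by (auto, metis add_diff_cancel_left' add.commute atLeastAtMost_iff diff_ge_0_iff_ge
        diff_add_cancel diff_le_eq)
  then show ?thesis unfolding germ_zero by simp
qed

lemma conjugate_moves: "x \<in> PL \<Longrightarrow> h \<in> PL \<Longrightarrow> (h \<circ> (x \<circ> inv h)) t \<noteq> t \<longleftrightarrow> x (inv h t) \<noteq> inv h t"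
  using PL_eq[of h "x (inv h t)" "inv h t"] by simp

lemma inv_moves: "x \<in> PL \<Longrightarrow> inv x t = t \<longleftrightarrow> x t = t"
  by (metis PL_inv)

lemma commute_inv:
  assumes "x \<in> PL" "y \<in> PL" "\<And>t. x (y t) = y (x t)" shows "x (inv y t) = inv y (x t)"
  by (metis assms PL_inv)

text \<open>The initial segment from \<open>p\<close> on which \<open>c\<close> is the identity is
  preserved by \<open>u\<close>, because \<open>c\<close> commutes with \<open>u\<close> and
  \<open>u\<close> fixes \<open>p\<close>. If it ended before reaching \<open>t\<close>, its end
  would be moved upwards by \<open>u\<close> or by the inverse of \<open>u\<close>, which would
  enlarge it.\<close>

lemma rigid:
  assumes c: "c \<in> PL" and u: "u \<in> PL" and comm: "\<And>s. c (u s) = u (c s)" and fixp: "u p = p"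
    and germ: "germ p 1 c 0" and moved: "\<And>s. p < s \<Longrightarrow> s \<le> t \<Longrightarrow> u s \<noteq> s" and t: "p < t"
  shows "c t = t"
proof (rule ccontr)
  assume ct: "c t \<noteq> t"
  obtain e where e: "e > 0" "\<forall>s\<in>{p..p + e}. c s = s" using germ unfolding germ_zero_right by blast
  define T where "T = {s. p \<le> s \<and> s \<le> t \<and> (\<forall>y\<in>{p..s}. c y = y)}"
  have T: "bdd_above T" "min t (p + e) \<in> T" using e t by (auto simp: T_def intro: bdd_aboveI)
  define s where "s = Sup T"
  have "min t (p + e) \<le> s" unfolding s_def by (rule cSup_upper[OF T(2,1)])
  then have ps: "p < s" using t e(1) by simp
  have "s \<le> t" unfolding s_def using T(2) by (intro cSup_least) (auto simp: T_def)
  have below: "c y = y" if "p \<le> y" "y < s" for y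
    using that less_cSup_iff[of T y] T unfolding s_def T_def by fastforce
  \<comment> \<open>\<open>v\<close> is \<open>u\<close> or its inverse, whichever moves the end
    \<open>s\<close> of the segment upwards.\<close>
  obtain v where v: "v \<in> PL" "v p = p" "s < v s" "\<And>y. c (v y) = v (c y)"
  proof (cases "s < u s")
    case True
    then show ?thesis by (intro that[of u] u fixp comm)
  next
    case False
    then have "u s < s" using moved[OF ps \<open>s \<le> t\<close>] by simp
    then have "s < inv u s" using PL_less[OF u, of s "inv u s"] u by simp
    moreover have "inv u p = p" using inv_moves[OF u] fixp by simp
    ultimately show ?thesis
      by (intro that[of "inv u"] PL_inv_closed u commute_inv[OF c u comm])
  qed
  have fixed: "c y = y" if y: "p \<le> y" "y < v s" for y
  proof -
    have "p \<le> inv v y" "inv v y < s"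
      using PL_le[OF v(1), of p "inv v y"] PL_less[OF v(1), of "inv v y" s] v(1,2) y by simp_all
    then have "c (inv v y) = inv v y" by (rule below)
    then show ?thesis using v(4)[of "inv v y"] v(1) by simp
  qed
  have "v s \<le> t"
  proof (rule ccontr)
    assume "\<not> v s \<le> t"
    then show False using fixed[of t] ct t by simp
  qed
  then have "(s + v s) / 2 \<in> T" using fixed ps v(3) by (auto simp: T_def)
  then have "(s + v s) / 2 \<le> s" unfolding s_def using T(1) by (rule cSup_upper)
  then show False using v(3) by simp
qed

text \<open>These are the left ends of the components of the support of \<open>u\<close>: a
  nontrivial right germ moves all points immediately to the right of \<open>p\<close>.\<close>

definition left_ends :: "(real \<Rightarrow> real) \<Rightarrow> real set" where
  "left_ends u = {p\<in>{0..<r}. u p = p \<and> \<not> germ p 1 u 0}"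

text \<open>Two fixed points on one affine piece force slope \<open>1\<close> there. So the map
  \<open>f\<close>, which sends a left end to the last breakpoint not beyond it, is
  injective.\<close>

lemma finite_left_ends:
  assumes u: "u \<in> PL" shows "finite (left_ends u)"
proof -
  obtain P where P: "finite P" "affine_off u P" using u unfolding PL_def by blast
  define f where "f p = Max (insert 0 P \<inter> {..p})" for p :: real
  have f: "f p \<in> insert 0 P" "f p \<le> p" "\<And>q. q \<in> P \<Longrightarrow> q \<le> p \<Longrightarrow> q \<le> f p" if "0 \<le> p" for p
  proof -
    have F: "finite (insert 0 P \<inter> {..p})" "insert 0 P \<inter> {..p} \<noteq> {}" using P(1) that by auto
    show "f p \<in> insert 0 P" "f p \<le> p" using Max_in[OF F] by (auto simp: f_def)
    show "q \<le> f p" if "q \<in> P" "q \<le> p" for q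
      unfolding f_def by (rule Max_ge[OF F(1)]) (use that in auto)
  qed
  have "False" if pq: "p \<in> left_ends u" "q \<in> left_ends u" "p < q" "f p = f q" for p q
  proof -
    have p: "0 \<le> p" "u p = p" "\<not> germ p 1 u 0" and q: "0 \<le> q" "u q = q"
      using pq by (auto simp: left_ends_def)
    have "P \<inter> {p<..<q} = {}" using f(3)[OF q(1)] f(2)[OF p(1)] pq(4) by fastforce
    then obtain k :: int where k: "\<forall>t\<in>{p..q}. u t = u p + g powi k * (t - p)"
      using affine_offD[OF P(2) pq(3)] by blast
    have "q = p + g powi k * (q - p)" using bspec[OF k, of q] pq(3) p q by simp
    then have "(g powi k - 1) * (q - p) = 0" by (simp add: algebra_simps)
    then have "g powi k = 1" using pq(3) by simp
    then have "u t = t" if "t \<in> {p..q}" for t using bspec[OF k that] p by simp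
    then have "germ p 1 u 0" unfolding germ_zero_right using pq(3) by (intro exI[of _ "q - p"]) auto
    then show False using p by simp
  qed
  then have "inj_on f (left_ends u)" by (metis inj_onI linorder_neqE)
  moreover have "f ` left_ends u \<subseteq> insert 0 P" using f(1) by (auto simp: left_ends_def)
  ultimately show ?thesis using P(1) by (meson finite_insert inj_on_finite)
qed

text \<open>An element of the centralizer maps the finite set of left ends into itself, and a
  strictly increasing map can do so only by fixing each point.\<close>

lemma left_ends_fixed:
  assumes a: "a \<in> PL" and u: "u \<in> PL" and comm: "\<And>s. a (u s) = u (a s)" and p: "p \<in> left_ends u"
  shows "a p = p"
proof -
  have img: "a q \<in> left_ends u" if q: "q \<in> left_ends u" for q
  proof -
    have q': "0 \<le> q" "q < r" "u q = q" "\<not> germ q 1 u 0" using q by (auto simp: left_ends_def)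
    have "\<not> germ (a q) 1 u 0"
    proof
      assume "germ (a q) 1 u 0"
      then obtain e where e: "e > 0" "\<forall>t\<in>{a q..a q + e}. u t = t" unfolding germ_zero_right by blast
      have lt: "q < inv a (a q + e)" using PL_less[OF a, of q "inv a (a q + e)"] a e(1) by simp
      have "u t = t" if "t \<in> {q..q + (inv a (a q + e) - q)}" for t
      proof -
        have "a t \<in> {a q..a q + e}" using PL_le[OF a, of t "inv a (a q + e)"] that a by simp
        then have "a (u t) = a t" using e(2) comm by simp
        then show ?thesis using a by simp
      qed
      then have "germ q 1 u 0" unfolding germ_zero_right
        using lt by (intro exI[of _ "inv a (a q + e) - q"]) simp
      then show False using q'(4) by simp
    qed
    then show ?thesis using q' comm[of q] PL_range[OF a, of q] by (simp add: left_ends_def)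
  qed
  note fin = finite_left_ends[OF u]
  have "\<not> p < a p"
  proof
    assume lt: "p < a p"
    let ?S = "{q \<in> left_ends u. q < a q}"
    have S: "finite ?S" "?S \<noteq> {}" using fin p lt by auto
    have "Max ?S \<in> ?S" by (rule Max_in[OF S])
    then have "a (Max ?S) \<in> ?S" "Max ?S < a (Max ?S)" using img a by auto
    then show False using Max_ge[OF S(1)] by fastforce
  qed
  moreover have "\<not> a p < p"
  proof
    assume lt: "a p < p"
    let ?S = "{q \<in> left_ends u. a q < q}"
    have S: "finite ?S" "?S \<noteq> {}" using fin p lt by auto
    have "Min ?S \<in> ?S" by (rule Min_in[OF S])
    then have "a (Min ?S) \<in> ?S" "a (Min ?S) < Min ?S" using img a by auto
    then show False using Min_le[OF S(1)] by fastforce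
  qed
  ultimately show ?thesis by simp
qed

text \<open>On each component of the support of \<open>u\<close>, the centralizer of \<open>u\<close> fixes the left end and is
  determined there by its germ, hence is abelian.\<close>

lemma centralizer_abelian_on_support:
  assumes a: "a \<in> PL" and b: "b \<in> PL" and u: "u \<in> PL"
    and au: "\<And>s. a (u s) = u (a s)" and bu: "\<And>s. b (u s) = u (b s)" and t: "u t \<noteq> t"
  shows "a (b t) = b (a t)"
proof -
  \<comment> \<open>The supremum \<open>p\<close> of \<open>S\<close> will be the left end of the
    component of the support that contains \<open>t\<close>.\<close>
  define S where "S = {s. 0 \<le> s \<and> s \<le> t \<and> u s = s}"
  have tr: "0 < t" "t < r" using PL_moved[OF u t] by simp_all
  have S: "0 \<in> S" "bdd_above S" using tr u by (auto simp: S_def intro: bdd_aboveI)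
  define p where "p = Sup S"
  have up: "s \<le> p" if "s \<in> S" for s unfolding p_def by (rule cSup_upper[OF that S(2)])
  have "p \<le> t" unfolding p_def using S(1) by (intro cSup_least) (auto simp: S_def)
  have ex: "\<exists>s\<in>S. y < s" if "y < p" for y
    using that less_cSup_iff[of S y] S unfolding p_def by auto
  have fixp: "u p = p"
  proof (rule antisym)
    show "u p \<le> p"
    proof (rule ccontr)
      assume "\<not> u p \<le> p"
      then have "inv u p < p" using PL_less[OF u, of "inv u p" p] u by simp
      then obtain s where s: "s \<in> S" "inv u p < s" using ex by blast
      then have "p < s" using PL_less[OF u, of "inv u p" s] u by (simp add: S_def)
      then show False using up[OF s(1)] by simp
    qed
    show "p \<le> u p"
    proof (rule ccontr)
      assume "\<not> p \<le> u p"
      then obtain s where s: "s \<in> S" "u p < s" using ex[of "u p"] by auto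
      then show False using PL_le[OF u, of s p] up[OF s(1)] by (simp add: S_def)
    qed
  qed
  have p0: "0 \<le> p" by (rule up[OF S(1)])
  have pt: "p < t" using \<open>p \<le> t\<close> fixp t by (cases "p = t") auto
  have moved: "u s \<noteq> s" if "p < s" "s \<le> t" for s
    using that up[of s] p0 by (auto simp: S_def)
  have "\<not> germ p 1 u 0"
  proof
    assume "germ p 1 u 0"
    then obtain e where e: "e > 0" "\<forall>s\<in>{p..p + e}. u s = s" unfolding germ_zero_right by blast
    have "u (min t (p + e)) = min t (p + e)" using e pt by auto
    then show False using moved[of "min t (p + e)"] pt e(1) by auto
  qed
  then have lend: "p \<in> left_ends u" using p0 pt tr fixp by (simp add: left_ends_def)
  have ap: "a p = p" "b p = p"
    using left_ends_fixed[OF a u au lend] left_ends_fixed[OF b u bu lend] by simp_all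
  obtain k where k: "germ p 1 a k" using germ_ex[OF a ap(1)] by blast
  obtain l where l: "germ p 1 b l" using germ_ex[OF b ap(2)] by blast
  \<comment> \<open>\<open>c\<close> is a commutator of \<open>a\<close> and \<open>b\<close> and
    has to fix \<open>t\<close>. Its germ at \<open>p\<close> is trivial because exponents add up
    regardless of the order of the factors, so \<open>rigid\<close> applies.\<close>
  define c where "c = inv (b \<circ> a) \<circ> (a \<circ> b)"
  have ba: "b \<circ> a \<in> PL" and ab: "a \<circ> b \<in> PL" using a b by (simp_all add: PL_comp)
  then have c: "c \<in> PL" unfolding c_def by (rule_tac PL_comp[OF _ PL_inv_closed])
  have "\<exists>m. germ p 1 (inv (b \<circ> a)) m"
    using inv_moves[OF ba, of p] ap by (intro germ_ex PL_inv_closed ba) auto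
  then obtain m where m: "germ p 1 (inv (b \<circ> a)) m" by blast
  have "germ p 1 (inv (b \<circ> a) \<circ> (b \<circ> a)) (k + l + m)" by (intro germ_comp k l m)
  moreover have "inv (b \<circ> a) \<circ> (b \<circ> a) = id" using PL_inv(2)[OF ba] by (auto simp: fun_eq_iff)
  moreover have "germ p 1 id 0" by (simp add: germ_zero exI[of _ 1])
  ultimately have "k + l + m = 0" using germ_unique[of p 1 id "k + l + m" 0] by simp
  moreover have "germ p 1 c (l + k + m)" unfolding c_def by (intro germ_comp k l m)
  ultimately have "germ p 1 c 0" by (simp add: add.commute)
  moreover have "c (u s) = u (c s)" for s
  proof -
    have "u (inv (b \<circ> a) y) = inv (b \<circ> a) (u y)" for y
      by (rule commute_inv[OF u ba]) (simp add: au bu)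
    then show ?thesis by (simp add: c_def au bu)
  qed
  ultimately have "c t = t" using rigid[OF c u _ fixp _ moved pt] by blast
  then have "(b \<circ> a) (c t) = (b \<circ> a) t" by simp
  then show ?thesis using PL_inv(1)[OF ba] by (simp add: c_def)
qed

section \<open>Bumps\<close>

text \<open>The graph has a piece of slope \<open>g powi k\<close> starting at \<open>p\<close>, a
  translation in the middle, and a piece of slope \<open>g powi (- k)\<close> ending at
  \<open>q\<close>. As a combination of maxima and minima of increasing affine maps it is continuous
  and increasing at once.\<close>

lemma bump:
  assumes p: "p \<in> A" "0 \<le> p" and q: "q \<in> A" "q \<le> r" and pq: "p < q" and k: "0 < k"
  obtains x where "x \<in> PL" "\<And>t. t \<le> x t" "\<And>t. x t = t \<longleftrightarrow> t \<le> p \<or> q \<le> t"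
    "germ p 1 x k" "germ q (-1) x (- k)"
proof -
  define G where "G = g powi k"
  define H where "H = g powi (- k)"
  have G1: "1 < G" using power_int_strict_increasing[of 0 k g] k g_gt_1 by (simp add: G_def)
  have HG: "H * G = 1" by (simp add: G_def H_def g_powi_minus)
  have H0: "0 < H" by (simp add: H_def)
  have H1: "H < 1"
  proof (rule ccontr)
    assume "\<not> H < 1"
    then have "1 * G \<le> H * G" using G1 by (intro mult_right_mono) auto
    then show False using HG G1 by simp
  qed
  \<comment> \<open>The first piece has length \<open>d\<close> and the last one
    \<open>G * d\<close>; \<open>d\<close> is so small that the first ends before the last
    begins.\<close>
  obtain d where d: "d \<in> A" "0 < d" "d < (q - p) / (1 + G)"
    using A_small[of "(q - p) / (1 + G)"] pq G1 by auto
  have dpq: "p + d < q - G * d" using d(3) G1 by (simp add: field_simps)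
  define u where "u t = p + G * (t - p)" for t
  define v where "v t = t + (G - 1) * d" for t
  define w where "w t = q + H * (t - q)" for t
  define x where "x t = max t (min (u t) (min (v t) (w t)))" for t
  have diff: "u t - t = (G - 1) * (t - p)" "v t - t = (G - 1) * d" "w t - t = (1 - H) * (q - t)"
    "v t - u t = (G - 1) * (p + d - t)" for t
    by (simp_all add: u_def v_def w_def algebra_simps)
  have diff': "w t - v t = (1 - H) * (q - G * d - t)" for t
  proof -
    have "(1 - H) * (q - G * d - t) = q - G * d - t - H * q + (H * G) * d + H * t"
      by (simp add: algebra_simps)
    then show ?thesis using HG by (simp add: w_def v_def algebra_simps)
  qed
  have vt: "t < v t" for t using diff(2)[of t] mult_pos_pos[of "G - 1" d] G1 d(2) by linarith
  have sgn: "u t \<le> t \<longleftrightarrow> t \<le> p" "w t \<le> t \<longleftrightarrow> q \<le> t" "v t \<le> u t \<longleftrightarrow> p + d \<le> t" "w t \<le> v t \<longleftrightarrow> q - G * d \<le> t"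
    "t \<le> u t \<longleftrightarrow> p \<le> t" "t \<le> w t \<longleftrightarrow> t \<le> q" "u t \<le> v t \<longleftrightarrow> t \<le> p + d" "v t \<le> w t \<longleftrightarrow> t \<le> q - G * d" for t
  proof -
    have pos: "0 < G - 1" "0 < 1 - H" using G1 H1 by simp_all
    have sign: "(X \<le> Y \<longleftrightarrow> z \<le> 0) \<and> (Y \<le> X \<longleftrightarrow> 0 \<le> z)" if "0 < c" "X - Y = c * z" for X Y c z :: real
    proof -
      have "X \<le> Y \<longleftrightarrow> c * z \<le> 0" "Y \<le> X \<longleftrightarrow> 0 \<le> c * z" using that(2) by linarith+
      then show ?thesis using that(1) by (auto simp: mult_le_0_iff zero_le_mult_iff)
    qed
    show "u t \<le> t \<longleftrightarrow> t \<le> p" "t \<le> u t \<longleftrightarrow> p \<le> t" using sign[OF pos(1) diff(1)] by auto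
    show "w t \<le> t \<longleftrightarrow> q \<le> t" "t \<le> w t \<longleftrightarrow> t \<le> q" using sign[OF pos(2) diff(3)] by auto
    show "v t \<le> u t \<longleftrightarrow> p + d \<le> t" "u t \<le> v t \<longleftrightarrow> t \<le> p + d" using sign[OF pos(1) diff(4)] by auto
    show "w t \<le> v t \<longleftrightarrow> q - G * d \<le> t" "v t \<le> w t \<longleftrightarrow> t \<le> q - G * d"
      using sign[OF pos(2) diff'] by auto
  qed
  have "0 < G * d" using G1 d(2) by simp
  have zones: "t \<le> p \<Longrightarrow> x t = t" "p \<le> t \<Longrightarrow> t \<le> p + d \<Longrightarrow> x t = u t"
    "p + d \<le> t \<Longrightarrow> t \<le> q - G * d \<Longrightarrow> x t = v t" "q - G * d \<le> t \<Longrightarrow> t \<le> q \<Longrightarrow> x t = w t"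
    "q \<le> t \<Longrightarrow> x t = t" for t
  proof -
    show "x t = t" if "t \<le> p" using sgn(1)[of t] that by (simp add: x_def min_def max_def)
    show "x t = t" if "q \<le> t" using sgn(2)[of t] that by (simp add: x_def min_def max_def)
    show "x t = u t" if "p \<le> t" "t \<le> p + d"
    proof -
      have "t \<le> u t" "u t \<le> v t" "v t \<le> w t" using sgn[of t] that dpq by simp_all
      then show ?thesis by (simp add: x_def min_def max_def)
    qed
    show "x t = v t" if "p + d \<le> t" "t \<le> q - G * d"
    proof -
      have "v t \<le> u t" "v t \<le> w t" using sgn[of t] that by simp_all
      then show ?thesis using vt[of t] by (simp add: x_def min_def max_def)
    qed
    show "x t = w t" if "q - G * d \<le> t" "t \<le> q"
    proof -
      have "t \<le> w t" "w t \<le> v t" "v t \<le> u t" using sgn[of t] that dpq by simp_all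
      then show ?thesis by (simp add: x_def min_def max_def)
    qed
  qed
  have mono: "strict_mono x"
  proof (rule strict_monoI)
    fix s t :: real assume st: "s < t"
    have "u s < u t" "v s < v t" "w s < w t" using st G1 H0 by (simp_all add: u_def v_def w_def)
    then show "x s < x t" using st by (auto simp: x_def max_def min_def)
  qed
  have "continuous_on UNIV x" unfolding x_def u_def v_def w_def by (intro continuous_intros)
  have surj: "surj x"
  proof (rule surjI[where f = "\<lambda>y. SOME t. x t = y"])
    fix y
    have "\<exists>t\<ge>min y p. t \<le> max y q \<and> x t = y"
      by (rule IVT')
        (use zones(1)[of "min y p"] zones(5)[of "max y q"] pq \<open>continuous_on UNIV x\<close>
          in \<open>auto intro: continuous_on_subset\<close>)
    then show "x (SOME t. x t = y) = y" by (metis (mono_tags, lifting) someI_ex)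
  qed
  have affine: "affine_off x {p, p + d, q - G * d, q}"
    unfolding affine_off_def
  proof (intro allI impI)
    fix a b :: real assume ab: "a < b" "{p, p + d, q - G * d, q} \<inter> {a<..<b} = {}"
    then consider "b \<le> p" | "p \<le> a" "b \<le> p + d" | "p + d \<le> a" "b \<le> q - G * d"
      | "q - G * d \<le> a" "b \<le> q" | "q \<le> a" using d(2) dpq \<open>0 < G * d\<close> by fastforce
    then show "\<exists>l::int. \<forall>t\<in>{a..b}. x t = x a + g powi l * (t - a)"
    proof cases
      case 1
      then show ?thesis using zones(1) ab(1) by (intro exI[of _ 0]) auto
    next
      case 2
      have "x t = x a + g powi k * (t - a)" if "t \<in> {a..b}" for t
        using zones(2)[of a] zones(2)[of t] ab(1) 2 that by (simp add: u_def G_def algebra_simps)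
      then show ?thesis by blast
    next
      case 3
      then show ?thesis using zones(3) ab(1) by (intro exI[of _ 0]) (auto simp: v_def)
    next
      case 4
      have "x t = x a + g powi (- k) * (t - a)" if "t \<in> {a..b}" for t
        using zones(4)[of a] zones(4)[of t] ab(1) 4 that by (simp add: w_def H_def algebra_simps)
      then show ?thesis by blast
    next
      case 5
      then show ?thesis using zones(5) ab(1) by (intro exI[of _ 0]) auto
    qed
  qed
  have "G * d \<in> A" unfolding G_def by (rule A_scale[OF d(1)])
  then have sub: "{p, p + d, q - G * d, q} \<subseteq> A" using A_add[OF p(1) d(1)] A_diff[OF q(1)] p(1) q(1) by simp
  have out: "x t = t" if "t \<notin> {0..<r}" for t using that p(2) q(2) zones(1,5)[of t] by (cases "t < 0") simp_all
  have "\<exists>P. finite P \<and> P \<subseteq> A \<and> affine_off x P"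
    by (intro exI[of _ "{p, p + d, q - G * d, q}"] conjI affine sub) simp
  then have "x \<in> PL" unfolding PL_def using mono surj out by simp
  moreover have "t \<le> x t" for t by (simp add: x_def)
  moreover have "x t = t \<longleftrightarrow> t \<le> p \<or> q \<le> t" for t
  proof
    assume "x t = t"
    then have "u t \<le> t \<or> v t \<le> t \<or> w t \<le> t" by (auto simp: x_def max_def min_def split: if_splits)
    then show "t \<le> p \<or> q \<le> t" using sgn[of t] vt[of t] by auto
  qed (use zones(1,5) in auto)
  moreover have "germ p 1 x k"
    unfolding germ_def using d(2) zones(2)
    by (intro exI[of _ d]) (auto simp: u_def G_def)
  moreover have "germ q (-1) x (- k)"
    unfolding germ_def using d(2) G1 zones(4)
    by (intro exI[of _ "G * d"]) (auto simp: w_def H_def)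
  ultimately show thesis by (rule that)
qed

lemma bump_support:
  assumes "p \<in> A" "0 \<le> p" "q \<in> A" "q \<le> r" "p < q"
  shows "\<exists>x\<in>PL. \<forall>t. t \<le> x t \<and> (x t = t \<longleftrightarrow> t \<le> p \<or> q \<le> t)"
proof (rule bump[OF assms zero_less_one])
  fix x assume "x \<in> PL" "\<And>t. t \<le> x t" "\<And>t. x t = t \<longleftrightarrow> t \<le> p \<or> q \<le> t"
  then show ?thesis by blast
qed

lemma bump_at:
  assumes "a < t" "t < b" "0 \<le> a" "b \<le> r"
  shows "\<exists>x\<in>PL. x t \<noteq> t \<and> (\<forall>s. x s \<noteq> s \<longrightarrow> a < s \<and> s < b)"
proof -
  obtain p where p: "p \<in> A" "a < p" "p < t" using A_dense[OF assms(1)] .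
  obtain q where q: "q \<in> A" "t < q" "q < b" using A_dense[OF assms(2)] .
  have ord: "0 \<le> p" "q \<le> r" "p < q" using p q assms by auto
  obtain x where x: "x \<in> PL" "\<And>t. x t = t \<longleftrightarrow> t \<le> p \<or> q \<le> t"
    using bump_support[OF p(1) ord(1) q(1) ord(2,3)] by blast
  have "x t \<noteq> t" using x(2) p q by auto
  moreover have "a < s \<and> s < b" if "x s \<noteq> s" for s using that x(2)[of s] p q by auto
  ultimately show ?thesis using x(1) by blast
qed

text \<open>The two supports overlap in such a way that \<open>x\<close> moves the left end
  \<open>p2\<close> of the support of \<open>y\<close> into that support, while \<open>y\<close>
  fixes it.\<close>

lemma non_commuting_bumps:
  assumes "a < b" "0 \<le> a" "b \<le> r"
  shows "\<exists>x\<in>PL. \<exists>y\<in>PL. \<exists>t. (\<forall>s. x s \<noteq> s \<longrightarrow> a < s \<and> s < b) \<and>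
    (\<forall>s. y s \<noteq> s \<longrightarrow> a < s \<and> s < b) \<and> x (y t) \<noteq> y (x t)"
proof -
  obtain p1 where p1: "p1 \<in> A" "a < p1" "p1 < b" using A_dense[OF assms(1)] .
  obtain p2 where p2: "p2 \<in> A" "p1 < p2" "p2 < b" using A_dense[OF p1(3)] .
  obtain q1 where q1: "q1 \<in> A" "p2 < q1" "q1 < b" using A_dense[OF p2(3)] .
  obtain q2 where q2: "q2 \<in> A" "q1 < q2" "q2 < b" using A_dense[OF q1(3)] .
  have ord: "0 \<le> p1" "q1 \<le> r" "p1 < q1" "0 \<le> p2" "q2 \<le> r" "p2 < q2" using p1 p2 q1 q2 assms by auto
  obtain x where x: "x \<in> PL" "\<And>t. t \<le> x t" "\<And>t. x t = t \<longleftrightarrow> t \<le> p1 \<or> q1 \<le> t"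
    using bump_support[OF p1(1) ord(1) q1(1) ord(2,3)] by blast
  obtain y where y: "y \<in> PL" "\<And>t. t \<le> y t" "\<And>t. y t = t \<longleftrightarrow> t \<le> p2 \<or> q2 \<le> t"
    using bump_support[OF p2(1) ord(4) q2(1) ord(5,6)] by blast
  have "p2 < x p2" using x(2)[of p2] x(3)[of p2] p2 q1 by force
  moreover have "x p2 < q2" using PL_less[OF x(1), of p2 q1] x(3)[of q1] q1 q2 by simp
  ultimately have "y (x p2) \<noteq> x p2" using y(3)[of "x p2"] by auto
  moreover have "y p2 = p2" using y(3) by simp
  ultimately have "x (y p2) \<noteq> y (x p2)" by simp
  moreover have "a < s \<and> s < b" if "x s \<noteq> s" for s using that x(3)[of s] p1 q1 by auto
  moreover have "a < s \<and> s < b" if "y s \<noteq> s" for s using that y(3)[of s] p1 p2 q2 by auto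
  ultimately show ?thesis using x(1) y(1) by blast
qed

section \<open>Elements without interior fixed points\<close>

lemma PL_funpow: "x \<in> PL \<Longrightarrow> x ^^ n \<in> PL"
  by (induction n) (simp_all add: PL_id[unfolded id_def] PL_comp id_def)

text \<open>A bounded orbit would have a supremum inside the interval, and one further application
  of \<open>z\<close> would take the orbit beyond it.\<close>

lemma push_up:
  assumes z: "z \<in> PL" and up: "\<And>t. 0 < t \<Longrightarrow> t < r \<Longrightarrow> t < z t" and a: "0 < a" "a < r" and b: "b < r"
  shows "\<exists>n. b < (z ^^ n) a"
proof (rule ccontr)
  assume "\<not> ?thesis"
  then have le: "(z ^^ n) a \<le> b" for n by (simp add: not_less)
  define s where "s = (SUP n. (z ^^ n) a)"
  have bdd: "bdd_above (range (\<lambda>n. (z ^^ n) a))" using le by (intro bdd_aboveI[of _ b]) auto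
  have upper: "(z ^^ n) a \<le> s" for n unfolding s_def by (rule cSUP_upper[OF UNIV_I bdd])
  have "a \<le> s" using upper[of 0] by simp
  moreover have "s \<le> b" unfolding s_def by (rule cSUP_least) (use le in auto)
  ultimately have s: "0 < s" "s < r" using a b by auto
  have "inv z s < s" using PL_less[OF z, of "inv z s" s] z up[OF s] by simp
  then obtain n where "inv z s < (z ^^ n) a"
    unfolding s_def using less_cSUP_iff[OF _ bdd] by auto
  then have "s < z ((z ^^ n) a)" using PL_less[OF z, of "inv z s"] z by simp
  then show False using upper[of "Suc n"] by simp
qed

definition free :: "(real \<Rightarrow> real) \<Rightarrow> bool" where
  "free z \<longleftrightarrow> (\<forall>t. 0 < t \<longrightarrow> t < r \<longrightarrow> z t \<noteq> t)"

lemma PL_continuous: "x \<in> PL \<Longrightarrow> continuous_on S x"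
  by (rule continuous_on_subset[of UNIV]) (auto intro!: continuous_onI_mono simp: PL_surj)

lemma free_sign:
  assumes z: "z \<in> PL" and free: "free z"
  shows "(\<forall>t. 0 < t \<longrightarrow> t < r \<longrightarrow> t < z t) \<or> (\<forall>t. 0 < t \<longrightarrow> t < r \<longrightarrow> z t < t)"
proof (rule ccontr)
  assume "\<not> ?thesis"
  then obtain s t where s: "0 < s" "s < r" "z s \<le> s" and t: "0 < t" "t < r" "t \<le> z t"
    by (auto simp: not_less)
  define d where "d y = z y - y" for y
  have cont: "continuous_on S d" for S
    unfolding d_def by (intro continuous_intros PL_continuous z)
  have "\<exists>y\<in>{min s t..max s t}. d y = 0"
  proof (cases "s \<le> t")
    case True
    then show ?thesis using IVT'[of d s 0 t] cont s t by (auto simp: d_def)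
  next
    case False
    then show ?thesis using IVT2'[of d s 0 t] cont s t by (auto simp: d_def)
  qed
  then obtain y where "min s t \<le> y" "y \<le> max s t" "z y = y" by (auto simp: d_def)
  then show False using free s t unfolding free_def by (metis max_less_iff_conj min_less_iff_conj
    order_le_less_trans order_less_le_trans)
qed

lemma free_displaces:
  assumes z: "z \<in> PL" and free: "free z" and a: "0 < a" and b: "b < r"
  shows "\<exists>h\<in>PL. (\<forall>t. h (z t) = z (h t)) \<and> (\<forall>s t. a \<le> s \<longrightarrow> s \<le> b \<longrightarrow> a \<le> t \<longrightarrow> t \<le> b \<longrightarrow> h s \<noteq> t)"
proof (cases "a < r \<and> 0 < b \<and> a \<le> b")
  \<comment> \<open>Here no point lies between \<open>a\<close> and \<open>b\<close>, so the
    identity works vacuously.\<close>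
  case False
  then show ?thesis using a b PL_id by (intro bexI[of _ id]) auto
next
  case True
  then have ar: "a < r" by simp
  \<comment> \<open>\<open>y\<close> is \<open>z\<close> or its inverse, whichever moves points
    upwards; its powers commute with \<open>z\<close>.\<close>
  obtain y where y: "y \<in> PL" "\<And>t. y (z t) = z (y t)" "\<And>t. 0 < t \<Longrightarrow> t < r \<Longrightarrow> t < y t"
  proof (cases "\<forall>t. 0 < t \<longrightarrow> t < r \<longrightarrow> t < z t")
    case True
    then show ?thesis using that[of z] z by blast
  next
    case False
    then have down: "\<And>t. 0 < t \<Longrightarrow> t < r \<Longrightarrow> z t < t" using free_sign[OF z free] by blast
    have "t < inv z t" if "0 < t" "t < r" for t
      using PL_less[OF z, of t "inv z t"] z down[OF that] by simp
    then show ?thesis using that[of "inv z"] PL_inv_closed[OF z] z by simp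
  qed
  obtain n where n: "b < (y ^^ n) a" using push_up[OF y(1,3) a ar b] by blast
  have yn: "y ^^ n \<in> PL" by (rule PL_funpow[OF y(1)])
  have comm: "(y ^^ n) (z t) = z ((y ^^ n) t)" for t by (induction n) (simp_all add: y(2))
  have "(y ^^ n) s \<noteq> t" if "a \<le> s" "t \<le> b" for s t using PL_le[OF yn, of a s] n that by force
  then show ?thesis using yn comm by blast
qed

end

section \<open>Definability of supports and germs\<close>

sublocale pl_data \<subseteq> G: fo_group PL Fmul "Finv r" Fone
  by unfold_locales (simp_all add: Fmul_def Fone_def PL_comp PL_id PL_inv_closed Finv_eq)

context pl_data
begin

section \<open>Commutation and disjoint supports\<close>

definition disjoint_supports :: "(real \<Rightarrow> real) \<Rightarrow> (real \<Rightarrow> real) \<Rightarrow> bool" where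
  "disjoint_supports x y \<longleftrightarrow> (\<forall>t. x t = t \<or> y t = t)"

lemma commute_iff: "G.commute x y \<longleftrightarrow> (\<forall>t. x (y t) = y (x t))"
  unfolding G.commute_def Fmul_def by (auto simp: fun_eq_iff)

lemma conj_by_eq: "h \<in> PL \<Longrightarrow> G.conj_by x h = h \<circ> (x \<circ> inv h)"
  by (simp add: G.conj_by_def Fmul_def Finv_eq)

lemma conj_by_PL: "x \<in> PL \<Longrightarrow> h \<in> PL \<Longrightarrow> G.conj_by x h \<in> PL"
  by (simp add: conj_by_eq PL_comp PL_inv_closed)

lemma conj_by_moves:
  "x \<in> PL \<Longrightarrow> h \<in> PL \<Longrightarrow> G.conj_by x h t \<noteq> t \<longleftrightarrow> x (inv h t) \<noteq> inv h t"
  using conjugate_moves by (simp add: conj_by_eq)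

lemma commutator_PL: "a \<in> PL \<Longrightarrow> b \<in> PL \<Longrightarrow> G.commutator a b \<in> PL"
  by (simp add: G.commutator_def)

text \<open>This form shows what the commutator moves: exactly the images under
  \<open>a \<circ> b\<close> of the points at which \<open>a\<close> and \<open>b\<close> fail to
  commute.\<close>

lemma commutator_apply:
  assumes "a \<in> PL" "b \<in> PL" shows "G.commutator a b (a (b t)) = b (a t)"
proof -
  have ab: "a \<circ> b \<in> PL" using assms by (simp add: PL_comp)
  have "G.commutator a b = (b \<circ> a) \<circ> inv (a \<circ> b)"
    using Finv_eq[OF ab] by (simp add: G.commutator_def Fmul_def)
  then show ?thesis using PL_inv(2)[OF ab, of t] by simp
qed

lemma commute_if_disjoint:
  assumes x: "x \<in> PL" and y: "y \<in> PL" and "disjoint_supports x y" shows "G.commute x y"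
  unfolding commute_iff
proof
  fix t
  have d: "x s = s \<or> y s = s" for s using assms(3) by (simp add: disjoint_supports_def)
  show "x (y t) = y (x t)"
  proof (cases "x t = t")
    case True
    then show ?thesis using d[of "y t"] y by (cases "y t = t") auto
  next
    case False
    then have "y t = t" "y (x t) = x t" using d[of t] d[of "x t"] x by auto
    then show ?thesis by simp
  qed
qed

text \<open>The midpoint of \<open>t\<close> and \<open>x t\<close> separates a neighbourhood of
  \<open>t\<close> from its image under \<open>x\<close>.\<close>

lemma displaced_interval:
  assumes x: "x \<in> PL" and t: "x t \<noteq> t" "c < t" "t < d"
  shows "\<exists>c' d'. c \<le> c' \<and> c' < t \<and> t < d' \<and> d' \<le> d \<and>
    (\<forall>s. c' < s \<longrightarrow> s < d' \<longrightarrow> \<not> (c' < x s \<and> x s < d'))"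
proof (cases "t < x t")
  case True
  define d' where "d' = min d ((t + x t) / 2)"
  define c' where "c' = max c (inv x d')"
  have "t < (t + x t) / 2" "(t + x t) / 2 < x t" using True by simp_all
  then have d': "t < d'" "d' \<le> d" "d' < x t" using t by (auto simp: d'_def min_less_iff_disj)
  have "inv x d' < t" using PL_less[OF x, of "inv x d'" t] x d'(3) by simp
  then have c': "c \<le> c'" "c' < t" "inv x d' \<le> c'" using t by (auto simp: c'_def)
  have "d' < x s" if "c' < s" for s using PL_less[OF x, of "inv x d'" s] x c'(3) that by simp
  then show ?thesis using c' d' by (intro exI[of _ c'] exI[of _ d']) force
next
  case False
  define c' where "c' = max c ((t + x t) / 2)"
  define d' where "d' = min d (inv x c')"
  have "(t + x t) / 2 < t" "x t < (t + x t) / 2" using False t by simp_all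
  then have c': "c \<le> c'" "c' < t" "x t < c'" using t by (auto simp: c'_def less_max_iff_disj)
  have "t < inv x c'" using PL_less[OF x, of t "inv x c'"] x c'(3) by simp
  then have d': "t < d'" "d' \<le> d" "d' \<le> inv x c'" using t by (auto simp: d'_def)
  have "x s < c'" if "s < d'" for s using PL_less[OF x, of s "inv x c'"] x d'(3) that by simp
  then show ?thesis using c' d' by (intro exI[of _ c'] exI[of _ d']) force
qed

text \<open>If \<open>w\<close> moved \<open>t\<close>, it would displace a small interval around
  \<open>t\<close> on which \<open>u\<close> is trivial. Two bumps in that interval commute with
  \<open>u\<close> and have a nontrivial commutator supported there; commuting with it,
  \<open>w\<close> would have to preserve its support.\<close>

lemma subsupp_fixes:
  assumes u: "u \<in> PL" and w: "w \<in> PL" and sub: "G.subsupp w u"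
    and cd: "0 \<le> c" "c < t" "t < d" "d \<le> r" and triv: "\<And>s. c < s \<Longrightarrow> s < d \<Longrightarrow> u s = s"
  shows "w t = t"
proof (rule ccontr)
  assume "w t \<noteq> t"
  then obtain c' d' where J: "c \<le> c'" "c' < t" "t < d'" "d' \<le> d"
    and disp: "\<And>s. c' < s \<Longrightarrow> s < d' \<Longrightarrow> \<not> (c' < w s \<and> w s < d')"
    using displaced_interval[OF w _ cd(2,3)] by blast
  have J': "c' < d'" "0 \<le> c'" "d' \<le> r" using J cd by auto
  obtain a b s where ab: "a \<in> PL" "b \<in> PL" and supp: "\<And>s. a s \<noteq> s \<Longrightarrow> c' < s \<and> s < d'"
    "\<And>s. b s \<noteq> s \<Longrightarrow> c' < s \<and> s < d'" and s: "a (b s) \<noteq> b (a s)"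
    using non_commuting_bumps[OF J'] by blast
  have "u s = s" if "c' < s" "s < d'" for s using triv[of s] J that by simp
  then have "disjoint_supports a u" "disjoint_supports b u"
    unfolding disjoint_supports_def using supp by blast+
  then have "G.commute a u" "G.commute b u" using commute_if_disjoint ab u by blast+
  then have comm: "G.commute w (G.commutator a b)" using sub ab unfolding G.subsupp_def by blast
  define k where "k = G.commutator a b"
  have k: "k \<in> PL" using commutator_PL ab by (simp add: k_def)
  have supp_k: "c' < y \<and> y < d'" if "k y \<noteq> y" for y
  proof (rule ccontr)
    assume "\<not> (c' < y \<and> y < d')"
    then have "a y = y" "b y = y" using supp by blast+
    then have "k y = y" using commutator_apply[OF ab, of y] by (simp add: k_def)
    then show False using that by simp
  qed
  have q: "k (a (b s)) \<noteq> a (b s)" using commutator_apply[OF ab] s by (simp add: k_def)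
  then have "k (w (a (b s))) \<noteq> w (a (b s))" using comm w by (simp add: commute_iff k_def[symmetric]) (metis PL_eq)
  then show False using disp supp_k q by blast
qed

text \<open>If the supports are disjoint, \<open>u\<close> is trivial near every point moved by
  \<open>v\<close>, so each \<open>w\<close> with \<open>subsupp w u\<close> fixes the support of
  \<open>v\<close>. If some point is moved by both, a bump \<open>w\<close> close to it satisfies
  \<open>subsupp w u\<close>, since the commutators of the centralizer of \<open>u\<close> are
  trivial on the support of \<open>u\<close>; but \<open>v\<close> displaces the support of
  \<open>w\<close>.\<close>

lemma perp_iff:
  assumes u: "u \<in> PL" and v: "v \<in> PL"
  shows "G.perp u v \<longleftrightarrow> disjoint_supports u v"
proof
  assume disj: "disjoint_supports u v"
  show "G.perp u v"
    unfolding G.perp_def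
  proof (intro ballI impI)
    fix w assume w: "w \<in> PL" and sub: "G.subsupp w u"
    have "w t = t" if vt: "v t \<noteq> t" for t
    proof -
      have t: "0 < t" "t < r" using PL_moved[OF v vt] by auto
      obtain c d where cd: "0 \<le> c" "c < t" "t < d" "d \<le> r"
        and disp: "\<And>s. c < s \<Longrightarrow> s < d \<Longrightarrow> \<not> (c < v s \<and> v s < d)"
        using displaced_interval[OF v vt t] by blast
      have "u s = s" if "c < s" "s < d" for s
        using disp[OF that] that disj unfolding disjoint_supports_def by metis
      then show ?thesis by (rule subsupp_fixes[OF u w sub cd])
    qed
    then show "G.commute w v" by (intro commute_if_disjoint w v) (auto simp: disjoint_supports_def)
  qed
next
  assume perp: "G.perp u v"
  show "disjoint_supports u v"
    unfolding disjoint_supports_def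
  proof (rule allI, rule ccontr)
    fix t assume "\<not> (u t = t \<or> v t = t)"
    then have ut: "u t \<noteq> t" and vt: "v t \<noteq> t" by auto
    have t: "0 < t" "t < r" using PL_moved[OF u ut] by auto
    obtain c d where cd: "0 \<le> c" "c < t" "t < d" "d \<le> r"
      and disp: "\<And>s. c < s \<Longrightarrow> s < d \<Longrightarrow> \<not> (c < u s \<and> u s < d)"
      using displaced_interval[OF u ut t] by blast
    obtain c' d' where cd': "c \<le> c'" "c' < t" "t < d'" "d' \<le> d"
      and disp': "\<And>s. c' < s \<Longrightarrow> s < d' \<Longrightarrow> \<not> (c' < v s \<and> v s < d')"
      using displaced_interval[OF v vt cd(2,3)] by blast
    have "0 \<le> c'" "d' \<le> r" using cd cd' by auto
    then obtain w where w: "w \<in> PL" "w t \<noteq> t" "\<And>s. w s \<noteq> s \<Longrightarrow> c' < s \<and> s < d'"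
      using bump_at[OF cd'(2,3)] by blast
    have "G.subsupp w u"
      unfolding G.subsupp_def
    proof (intro ballI impI, elim conjE)
      fix a b assume ab: "a \<in> PL" "b \<in> PL" "G.commute a u" "G.commute b u"
      have abu: "\<And>s. a (u s) = u (a s)" "\<And>s. b (u s) = u (b s)" using ab by (auto simp: commute_iff)
      have "G.commutator a b y = y" if "u y \<noteq> y" for y
      proof -
        \<comment> \<open>\<open>y\<close> is written as an image under \<open>a\<close> and
          \<open>b\<close> so that \<open>commutator_apply\<close> can be used. As both commute with
          \<open>u\<close>, the preimage \<open>z\<close> is moved by \<open>u\<close> too.\<close>
        define z where "z = inv b (inv a y)"
        have y: "y = a (b z)" using ab by (simp add: z_def)
        have "a (b (u z)) = u (a (b z))" by (simp add: abu)
        then have "u z \<noteq> z" using that y by metis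
        then have "a (b z) = b (a z)"
          by (rule centralizer_abelian_on_support[OF ab(1,2) u abu])
        then show ?thesis using commutator_apply[OF ab(1,2), of z] y by simp
      qed
      moreover have "u s \<noteq> s" if "w s \<noteq> s" for s using w(3)[OF that] disp[of s] cd' by auto
      ultimately show "G.commute w (G.commutator a b)"
        by (intro commute_if_disjoint w commutator_PL ab) (auto simp: disjoint_supports_def)
    qed
    then have "G.commute w v" using perp w(1) unfolding G.perp_def by blast
    then have "w (v t) \<noteq> v t" using w(2) v by (metis commute_iff PL_eq)
    then show False using w(2,3) disp' by blast
  qed
qed

section \<open>Slope exponents at the two ends\<close>

definition \<alpha> :: "(real \<Rightarrow> real) \<Rightarrow> int" where
  "\<alpha> x = (THE k. germ 0 1 x k)"

text \<open>Distances are measured from \<open>r\<close>, so a positive exponent means that points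
  near \<open>r\<close> move downwards, whereas at \<open>0\<close> it means that they move upwards.
  Hence the opposite signs for elements that move all points in one direction.\<close>

definition \<beta> :: "(real \<Rightarrow> real) \<Rightarrow> int" where
  "\<beta> x = (THE k. germ r (-1) x k)"

lemma \<alpha>_eq: "germ 0 1 x k \<Longrightarrow> \<alpha> x = k"
  unfolding \<alpha>_def by (rule the_equality) (auto intro: germ_unique)

lemma \<beta>_eq: "germ r (-1) x k \<Longrightarrow> \<beta> x = k"
  unfolding \<beta>_def by (rule the_equality) (auto intro: germ_unique)

lemma germ_\<alpha>: "x \<in> PL \<Longrightarrow> germ 0 1 x (\<alpha> x)"
  using germ_ex[of x 0 1] \<alpha>_eq by auto

lemma germ_\<beta>: "x \<in> PL \<Longrightarrow> germ r (-1) x (\<beta> x)"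
  using germ_ex[of x r "-1"] \<beta>_eq by auto

lemma \<alpha>_comp: "x \<in> PL \<Longrightarrow> y \<in> PL \<Longrightarrow> \<alpha> (y \<circ> x) = \<alpha> x + \<alpha> y"
  and \<beta>_comp: "x \<in> PL \<Longrightarrow> y \<in> PL \<Longrightarrow> \<beta> (y \<circ> x) = \<beta> x + \<beta> y"
  by (auto intro!: \<alpha>_eq \<beta>_eq germ_comp germ_\<alpha> germ_\<beta>)

lemma \<alpha>_zero: "0 < \<epsilon> \<Longrightarrow> (\<And>t. 0 \<le> t \<Longrightarrow> t \<le> \<epsilon> \<Longrightarrow> x t = t) \<Longrightarrow> \<alpha> x = 0"
  by (rule \<alpha>_eq) (auto simp: germ_zero intro!: exI[of _ \<epsilon>])

lemma \<beta>_zero: "0 < \<epsilon> \<Longrightarrow> (\<And>t. r - \<epsilon> \<le> t \<Longrightarrow> t \<le> r \<Longrightarrow> x t = t) \<Longrightarrow> \<beta> x = 0"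
  by (rule \<beta>_eq) (auto simp: germ_zero intro!: exI[of _ \<epsilon>])

lemma \<alpha>_zeroD: assumes "x \<in> PL" "\<alpha> x = 0" obtains \<epsilon> where "0 < \<epsilon>" "\<And>t. t \<le> \<epsilon> \<Longrightarrow> x t = t"
proof -
  have "germ 0 1 x 0" using germ_\<alpha>[OF assms(1)] assms(2) by simp
  then obtain e where e: "0 < e" "\<forall>t\<in>{0..0 + e}. x t = t" unfolding germ_zero_right by blast
  have "x t = t" if "t \<le> e" for t using e(2) that PL_outside[OF assms(1), of t] by (cases "0 \<le> t") auto
  then show thesis using that e(1) by blast
qed

lemma \<beta>_zeroD: assumes "x \<in> PL" "\<beta> x = 0" obtains \<epsilon> where "0 < \<epsilon>" "\<And>t. r - \<epsilon> \<le> t \<Longrightarrow> x t = t"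
proof -
  have "germ r (-1) x 0" using germ_\<beta>[OF assms(1)] assms(2) by simp
  then obtain e where e: "0 < e" "\<forall>h\<in>{0..e}. x (r + - 1 * h) = r + - 1 * h" unfolding germ_zero by blast
  have "x t = t" if "r - e \<le> t" for t
    using bspec[OF e(2), of "r - t"] that PL_outside[OF assms(1), of t] by (cases "t < r") auto
  then show thesis using that e(1) by blast
qed

lemma id_germs: "\<alpha> id = 0" "\<beta> id = 0"
  by (rule \<alpha>_zero[of 1] \<beta>_zero[of 1]; simp)+

lemma inv_germs: assumes "x \<in> PL" shows "\<alpha> (inv x) = - \<alpha> x" "\<beta> (inv x) = - \<beta> x"
proof -
  have "inv x \<circ> x = id" using assms by (auto simp: fun_eq_iff)
  then show "\<alpha> (inv x) = - \<alpha> x" "\<beta> (inv x) = - \<beta> x"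
    using \<alpha>_comp[OF assms PL_inv_closed[OF assms]] \<beta>_comp[OF assms PL_inv_closed[OF assms]] id_germs
    by simp_all
qed

lemma conj_by_germs:
  assumes "x \<in> PL" "h \<in> PL" shows "\<alpha> (G.conj_by x h) = \<alpha> x" "\<beta> (G.conj_by x h) = \<beta> x"
  using assms by (simp_all add: conj_by_eq \<alpha>_comp \<beta>_comp PL_comp PL_inv_closed inv_germs)

lemma germs_meet:
  assumes "germ p \<sigma> x k" "germ p \<sigma> y l" "k \<noteq> 0" "l \<noteq> 0" "\<sigma> = 1 \<or> \<sigma> = -1"
  shows "\<not> disjoint_supports x y"
proof -
  obtain a where a: "a > 0" "\<And>h. 0 < h \<and> h \<le> a \<Longrightarrow> x (p + \<sigma> * h) \<noteq> p + \<sigma> * h"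
    using germ_moves[OF assms(1,3,5)] by blast
  obtain b where b: "b > 0" "\<And>h. 0 < h \<and> h \<le> b \<Longrightarrow> y (p + \<sigma> * h) \<noteq> p + \<sigma> * h"
    using germ_moves[OF assms(2,4,5)] by blast
  show ?thesis unfolding disjoint_supports_def
    using a(2)[of "min a b"] b(2)[of "min a b"] a(1) b(1) by (metis min_less_iff_conj min.cobounded1 min.cobounded2)
qed

lemma disjoint_germs:
  assumes "x \<in> PL" "y \<in> PL" "disjoint_supports x y"
  shows "\<alpha> x = 0 \<or> \<alpha> y = 0" "\<beta> x = 0 \<or> \<beta> y = 0"
  using germs_meet[OF germ_\<alpha>[OF assms(1)] germ_\<alpha>[OF assms(2)]]
    germs_meet[OF germ_\<beta>[OF assms(1)] germ_\<beta>[OF assms(2)]] assms(3) by auto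

text \<open>The support of \<open>x\<close> lies in a compact part of the open interval, and a
  suitable power of \<open>z\<close> or of its inverse carries that part off itself.\<close>

lemma free_displaces_support:
  assumes z: "z \<in> PL" "free z" and x: "x \<in> PL" "\<alpha> x = 0" "\<beta> x = 0"
  shows "\<exists>h\<in>PL. G.commute h z \<and> G.perp (G.conj_by x h) x"
proof -
  obtain a where a: "0 < a" "\<And>t. t \<le> a \<Longrightarrow> x t = t" using \<alpha>_zeroD[OF x(1,2)] by blast
  obtain b where b: "0 < b" "\<And>t. r - b \<le> t \<Longrightarrow> x t = t" using \<beta>_zeroD[OF x(1,3)] by blast
  have "r - b < r" using b(1) by simp
  then obtain h where h: "h \<in> PL" "\<And>t. h (z t) = z (h t)"
    "\<And>s t. a \<le> s \<Longrightarrow> s \<le> r - b \<Longrightarrow> a \<le> t \<Longrightarrow> t \<le> r - b \<Longrightarrow> h s \<noteq> t"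
    using free_displaces[OF z a(1)] by blast
  have "disjoint_supports (G.conj_by x h) x"
    unfolding disjoint_supports_def
  proof (rule allI, rule ccontr)
    fix t assume "\<not> (G.conj_by x h t = t \<or> x t = t)"
    then have "x (inv h t) \<noteq> inv h t" "x t \<noteq> t" using conj_by_moves[OF x(1) h(1)] by auto
    then have "a \<le> inv h t" "inv h t \<le> r - b" "a \<le> t" "t \<le> r - b" using a(2) b(2) by (metis linear)+
    then have "h (inv h t) \<noteq> t" by (rule h(3))
    then show False using h(1) by simp
  qed
  then show ?thesis using h(1,2) x(1) by (intro bexI[of _ h]) (auto simp: perp_iff conj_by_PL commute_iff)
qed

lemma bump_0:
  assumes "c \<in> A" "0 < c" "c < r" "0 < k"
  shows "\<exists>x\<in>PL. \<alpha> x = k \<and> \<beta> x = 0 \<and> (\<forall>t. t \<le> x t \<and> (x t = t \<longleftrightarrow> t \<le> 0 \<or> c \<le> t))"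
proof (rule bump[of 0 c k])
  fix x assume x: "x \<in> PL" "\<And>t. t \<le> x t" "\<And>t. (x t = t) = (t \<le> 0 \<or> c \<le> t)" "germ 0 1 x k"
  have "\<beta> x = 0" by (rule \<beta>_zero[of "r - c"]) (use assms x(3) in auto)
  then show ?thesis using x \<alpha>_eq[OF x(4)] by blast
qed (use assms in auto)

lemma bump_r:
  assumes "c \<in> A" "0 < c" "c < r" "0 < k"
  shows "\<exists>x\<in>PL. \<alpha> x = 0 \<and> \<beta> x = - k \<and> (\<forall>t. t \<le> x t \<and> (x t = t \<longleftrightarrow> t \<le> c \<or> r \<le> t))"
proof (rule bump[of c r k])
  fix x assume x: "x \<in> PL" "\<And>t. t \<le> x t" "\<And>t. (x t = t) = (t \<le> c \<or> r \<le> t)" "germ r (-1) x (- k)"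
  have "\<alpha> x = 0" by (rule \<alpha>_zero[of c]) (use assms x(3) in auto)
  then show ?thesis using x \<beta>_eq[OF x(4)] by blast
qed (use assms r_in_A in auto)

text \<open>One bump at each end provides the prescribed exponent. The supports cover the open
  interval because \<open>d < c\<close>, and both bumps move points upwards, so nothing cancels in
  the product.\<close>

lemma free_ex_pos:
  assumes "0 < p" "0 < q"
  shows "\<exists>z\<in>PL. free z \<and> \<alpha> z = p \<and> \<beta> z = - q"
proof -
  obtain c where c: "c \<in> A" "0 < c" "c < r" using A_dense[OF r_pos] .
  obtain d where d: "d \<in> A" "0 < d" "d < c" using A_dense[OF c(2)] .
  obtain x where x: "x \<in> PL" "\<alpha> x = p" "\<beta> x = 0" "\<And>t. t \<le> x t \<and> (x t = t \<longleftrightarrow> t \<le> 0 \<or> c \<le> t)"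
    using bump_0[OF c assms(1)] by blast
  have "d < r" using c d by simp
  then obtain y where y: "y \<in> PL" "\<alpha> y = 0" "\<beta> y = - q" "\<And>t. t \<le> y t \<and> (y t = t \<longleftrightarrow> t \<le> d \<or> r \<le> t)"
    using bump_r[OF d(1,2) _ assms(2)] by blast
  have "free (y \<circ> x)"
    unfolding free_def
  proof (intro allI impI)
    fix t :: real assume t: "0 < t" "t < r"
    show "(y \<circ> x) t \<noteq> t"
    proof (cases "t < c")
      case True
      then have "t < x t" using x(4)[of t] t by force
      then show ?thesis using y(4)[of "x t"] by auto
    next
      case False
      then show ?thesis using x(4)[of t] y(4)[of t] t d by auto
    qed
  qed
  then show ?thesis using x y by (intro bexI[of _ "y \<circ> x"]) (auto simp: \<alpha>_comp \<beta>_comp PL_comp)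
qed

lemma free_inv: "z \<in> PL \<Longrightarrow> free z \<Longrightarrow> free (inv z)"
  using inv_moves by (simp add: free_def)

lemma free_ex:
  assumes "p * q < (0::int)" shows "\<exists>z\<in>PL. free z \<and> \<alpha> z = p \<and> \<beta> z = q"
proof (cases "0 < p")
  case True
  then have "0 < - q" using assms by (simp add: mult_less_0_iff)
  then show ?thesis using free_ex_pos[OF True] by fastforce
next
  case False
  then have "0 < - p" "0 < q" using assms by (auto simp: mult_less_0_iff)
  then obtain z where z: "z \<in> PL" "free z" "\<alpha> z = - p" "\<beta> z = - q" using free_ex_pos by blast
  then show ?thesis
    by (intro bexI[of _ "inv z"]) (simp_all add: inv_germs free_inv PL_inv_closed)
qed

text \<open>By \<open>free_sign\<close> points near both ends move in the same direction. Upwards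
  this means a slope above \<open>1\<close> at \<open>0\<close> and below \<open>1\<close> at
  \<open>r\<close>, and downwards the reverse.\<close>

lemma free_germs: assumes z: "z \<in> PL" "free z" shows "\<alpha> z * \<beta> z < 0"
proof -
  obtain a where a: "a > 0" "\<And>h. h \<in> {0..a} \<Longrightarrow> z (0 + 1 * h) = 0 + 1 * (g powi \<alpha> z * h)"
    using germ_\<alpha>[OF z(1)] unfolding germ_def by blast
  obtain b where b: "b > 0" "\<And>h. h \<in> {0..b} \<Longrightarrow> z (r + -1 * h) = r + -1 * (g powi \<beta> z * h)"
    using germ_\<beta>[OF z(1)] unfolding germ_def by blast
  define h where "h = min (r / 2) (min a b)"
  have h: "0 < h" "h < r" "h \<in> {0..a}" "h \<in> {0..b}" using a(1) b(1) r_pos by (auto simp: h_def)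
  have zh: "z h = g powi \<alpha> z * h" "z (r - h) = r - g powi \<beta> z * h" using a(2)[OF h(3)] b(2)[OF h(4)] by simp_all
  have sgn: "1 < g powi k \<longleftrightarrow> 0 < k" "g powi k < 1 \<longleftrightarrow> k < 0" for k :: int
    using power_int_strict_increasing[of 0 k g] power_int_strict_increasing[of k 0 g] g_gt_1
    by (cases k "0::int" rule: linorder_cases; simp)+
  have "h < z h \<and> r - h < z (r - h) \<or> z h < h \<and> z (r - h) < r - h"
    using free_sign[OF z] h by (metis diff_gt_0_iff_gt diff_less_eq less_add_same_cancel1)
  then have "1 < g powi \<alpha> z \<and> g powi \<beta> z < 1 \<or> g powi \<alpha> z < 1 \<and> 1 < g powi \<beta> z"
    unfolding zh using h(1) by simp
  then show ?thesis unfolding sgn by (auto simp: mult_less_0_iff)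
qed

section \<open>Meaning of the definable predicates\<close>

lemma small_iff: assumes x: "x \<in> PL" shows "G.small x \<longleftrightarrow> \<alpha> x = 0 \<and> \<beta> x = 0"
proof
  assume "G.small x"
  then obtain h where h: "h \<in> PL" "G.perp (G.conj_by x h) x" unfolding G.small_def by blast
  then have "disjoint_supports (G.conj_by x h) x" using perp_iff[OF conj_by_PL[OF x h(1)] x] by blast
  then show "\<alpha> x = 0 \<and> \<beta> x = 0"
    using disjoint_germs[OF conj_by_PL[OF x h(1)] x] conj_by_germs[OF x h(1)] by simp
next
  assume "\<alpha> x = 0 \<and> \<beta> x = 0"
  moreover obtain z where "z \<in> PL" "free z" using free_ex[of 1 "-1"] by auto
  ultimately show "G.small x" unfolding G.small_def using free_displaces_support[of z x] x by blast
qed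

lemma one_sided_iff: assumes x: "x \<in> PL" shows "G.one_sided x \<longleftrightarrow> \<alpha> x = 0 \<or> \<beta> x = 0"
proof
  assume "G.one_sided x"
  then obtain y where y: "y \<in> PL" "\<not> G.small y" "G.perp y x" unfolding G.one_sided_def by blast
  then have "disjoint_supports y x" using perp_iff x by blast
  then show "\<alpha> x = 0 \<or> \<beta> x = 0" using disjoint_germs[OF y(1) x] y(1,2) small_iff by auto
next
  assume "\<alpha> x = 0 \<or> \<beta> x = 0"
  then show "G.one_sided x"
  proof
    assume "\<alpha> x = 0"
    then obtain e where e: "0 < e" "\<And>t. t \<le> e \<Longrightarrow> x t = t" using \<alpha>_zeroD[OF x] by blast
    \<comment> \<open>The witness \<open>y\<close> is a bump at \<open>0\<close> that fits into the
      region where \<open>x\<close> is trivial.\<close>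
    obtain c where c: "c \<in> A" "0 < c" "c < min e r" using A_dense[of 0 "min e r"] e(1) r_pos by auto
    obtain y where y: "y \<in> PL" "\<alpha> y = 1" "\<And>t. t \<le> y t \<and> (y t = t \<longleftrightarrow> t \<le> 0 \<or> c \<le> t)"
      using bump_0[of c 1] c by auto
    have "disjoint_supports y x" unfolding disjoint_supports_def using y(3) e(2) c by fastforce
    then show ?thesis unfolding G.one_sided_def using y x by (intro bexI[of _ y]) (auto simp: perp_iff small_iff)
  next
    assume "\<beta> x = 0"
    then obtain e where e: "0 < e" "\<And>t. r - e \<le> t \<Longrightarrow> x t = t" using \<beta>_zeroD[OF x] by blast
    obtain c where c: "c \<in> A" "max 0 (r - e) < c" "c < r" using A_dense[of "max 0 (r - e)" r] e(1) r_pos by auto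
    obtain y where y: "y \<in> PL" "\<beta> y = -1" "\<And>t. t \<le> y t \<and> (y t = t \<longleftrightarrow> t \<le> c \<or> r \<le> t)"
      using bump_r[of c 1] c by auto
    have "disjoint_supports y x" unfolding disjoint_supports_def using y(3) e(2) c by fastforce
    then show ?thesis unfolding G.one_sided_def using y x by (intro bexI[of _ y]) (auto simp: perp_iff small_iff)
  qed
qed

lemma invariant_Inf:
  assumes h: "h \<in> PL" and S: "S \<noteq> {}" "bdd_below S" and inv: "\<And>t. h t \<in> S \<longleftrightarrow> t \<in> S"
  shows "h (Inf S) = Inf S"
proof (rule antisym)
  have low: "Inf S \<le> s" if "s \<in> S" for s by (rule cInf_lower[OF that S(2)])
  show "h (Inf S) \<le> Inf S"
  proof (rule cInf_greatest[OF S(1)])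
    fix s assume "s \<in> S"
    then have "inv h s \<in> S" using inv[of "inv h s"] h by simp
    then show "h (Inf S) \<le> s" using PL_le[OF h, of "Inf S" "inv h s"] low h by simp
  qed
  have "inv h (Inf S) \<le> Inf S"
  proof (rule cInf_greatest[OF S(1)])
    fix s assume "s \<in> S"
    then have "Inf S \<le> h s" using low inv by blast
    then show "inv h (Inf S) \<le> s" using PL_le[OF h, of "inv h (Inf S)" s] h by simp
  qed
  then show "Inf S \<le> h (Inf S)" using PL_le[OF h, of "inv h (Inf S)" "Inf S"] h by simp
qed

text \<open>If \<open>z\<close> is not free, then its whole centralizer fixes the leftmost interior boundary point of
  its fixed point set.\<close>

lemma transitive_iff: assumes z: "z \<in> PL" shows "G.transitive z \<longleftrightarrow> free z"
proof
  assume free: "free z"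
  have "z (r / 2) \<noteq> r / 2" using free[unfolded free_def, rule_format, of "r / 2"] r_pos by simp
  then have "z \<noteq> Fone" by (auto simp: Fone_def)
  then show "G.transitive z" unfolding G.transitive_def
    using free_displaces_support[OF z free] small_iff by blast
next
  assume tr: "G.transitive z"
  show "free z"
  proof (rule ccontr)
    assume "\<not> free z"
    then obtain t0 where t0: "0 < t0" "t0 < r" "z t0 = t0" unfolding free_def by blast
    have "z \<noteq> Fone" using tr unfolding G.transitive_def by blast
    then obtain t1 where t1: "z t1 \<noteq> t1" by (auto simp: fun_eq_iff Fone_def)
    have t1r: "0 < t1" "t1 < r" using PL_moved[OF z t1] by auto
    \<comment> \<open>If \<open>z\<close> is trivial near \<open>0\<close>, the point sought is
      where its support begins; otherwise it is the first interior fixed point. In both cases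
      \<open>S\<close> stays away from \<open>0\<close>, and the centralizer of \<open>z\<close>
      preserves it.\<close>
    define S where "S = (if \<alpha> z = 0 then {t. z t \<noteq> t} else {t. 0 < t \<and> t < r \<and> z t = t})"
    have "\<exists>e>0. \<forall>t\<in>S. e \<le> t"
    proof (cases "\<alpha> z = 0")
      case True
      obtain e where e: "e > 0" "\<And>t. t \<le> e \<Longrightarrow> z t = t" using \<alpha>_zeroD[OF z True] by blast
      have "e \<le> t" if "t \<in> S" for t
        using that True e(2)[of t] by (cases "t \<le> e") (auto simp: S_def)
      then show ?thesis using e(1) by blast
    next
      case False
      then obtain e where "e > 0" "\<forall>h. 0 < h \<and> h \<le> e \<longrightarrow> z (0 + 1 * h) \<noteq> 0 + 1 * h"
        using germ_moves[OF germ_\<alpha>[OF z]] by blast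
      then show ?thesis using False unfolding S_def by (intro exI[of _ e]) force
    qed
    then obtain e where e: "e > 0" "\<And>t. t \<in> S \<Longrightarrow> e \<le> t" by blast
    have "S \<noteq> {}" using t0 t1 by (auto simp: S_def)
    moreover have "bdd_below S" by (rule bdd_belowI[OF e(2)])
    ultimately have S: "S \<noteq> {}" "bdd_below S" .
    define q where "q = Inf S"
    have "e \<le> q" unfolding q_def by (rule cInf_greatest[OF S(1) e(2)])
    then have q0: "0 < q" using e(1) by simp
    obtain s where "s \<in> S" "s < r" using t0 t1 t1r by (cases "\<alpha> z = 0") (auto simp: S_def)
    then have qr: "q < r" using cInf_lower[OF _ S(2), of s] unfolding q_def by simp
    have fixq: "inv h q = q" if h: "h \<in> PL" "G.commute h z" for h
    proof -
      have "z (h t) = h t \<longleftrightarrow> z t = t" for t using h by (metis PL_eq commute_iff)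
      then have "h t \<in> S \<longleftrightarrow> t \<in> S" for t using PL_range[OF h(1)] by (simp add: S_def)
      then have "h q = q" unfolding q_def by (rule invariant_Inf[OF h(1) S])
      then show ?thesis using inv_moves[OF h(1)] by simp
    qed
    \<comment> \<open>A small \<open>u\<close> that moves \<open>q\<close> contradicts transitivity:
      its conjugates by elements fixing \<open>q\<close> move \<open>q\<close> as well.\<close>
    obtain u where u: "u \<in> PL" "u q \<noteq> q" "\<And>s. u s \<noteq> s \<Longrightarrow> q / 2 < s \<and> s < (q + r) / 2"
      using bump_at[of "q / 2" q "(q + r) / 2"] q0 qr by auto
    have "\<alpha> u = 0" by (rule \<alpha>_zero[of "q / 2"]) (use u(3) q0 in force)+
    moreover have "\<beta> u = 0" by (rule \<beta>_zero[of "(r - q) / 2"]) (use u(3) qr in \<open>force simp: field_simps\<close>)+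
    ultimately have "G.small u" using small_iff[OF u(1)] by simp
    then obtain h where h: "h \<in> PL" "G.commute h z" "G.perp (G.conj_by u h) u"
      using tr u(1) unfolding G.transitive_def by blast
    then have "disjoint_supports (G.conj_by u h) u" using perp_iff[OF conj_by_PL[OF u(1) h(1)] u(1)] by simp
    then show False using conj_by_moves[OF u(1) h(1), of q] fixq[OF h(1,2)] u(2)
      by (auto simp: disjoint_supports_def)
  qed
qed

end

section \<open>Verification of the abstract axioms and the final theorem\<close>

sublocale pl_data \<subseteq> G: two_ended_group PL Fmul "Finv r" Fone \<alpha> \<beta>
proof unfold_locales
  show "\<alpha> (Fmul x y) = \<alpha> x + \<alpha> y" "\<beta> (Fmul x y) = \<beta> x + \<beta> y" if "x \<in> PL" "y \<in> PL" for x y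
    using that by (simp_all add: Fmul_def \<alpha>_comp \<beta>_comp)
  show "\<exists>z\<in>PL. G.transitive z \<and> \<alpha> z = p \<and> \<beta> z = q" if "p * q < 0" for p q
    using free_ex[OF that] transitive_iff by blast
  show "\<beta> u = 0" if "z \<in> PL" "G.transitive z" "u \<in> PL" "G.commute u z" "\<alpha> u = 0" for z u
  proof -
    have free: "free z" using that transitive_iff by blast
    \<comment> \<open>As \<open>z\<close> has no interior fixed point, \<open>rigid\<close> applied
      at the end \<open>0\<close> reaches every interior point.\<close>
    have "u t = t" if "0 < t" "t < r" for t
    proof (rule rigid[of u z 0])
      show "germ 0 1 u 0" using germ_\<alpha>[of u] \<open>u \<in> PL\<close> \<open>\<alpha> u = 0\<close> by simp
      show "u (z s) = z (u s)" for s using \<open>G.commute u z\<close> by (simp add: commute_iff)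
    qed (use free that \<open>z \<in> PL\<close> \<open>u \<in> PL\<close> in \<open>auto simp: free_def\<close>)
    then have "u t = t" if "r - r / 2 \<le> t" "t \<le> r" for t
      using that PL_r[OF \<open>u \<in> PL\<close>] r_pos by (cases "t = r") auto
    then show ?thesis using r_pos by (intro \<beta>_zero[of "r / 2"]) auto
  qed
  show "\<alpha> z * \<beta> z < 0" if "z \<in> PL" "G.transitive z" for z
    using that free_germs transitive_iff by blast
qed (auto simp: Fmul_def Fone_def Finv_eq fun_eq_iff small_iff one_sided_iff)

theorem theoremB:
  fixes r :: real and L A :: "real set"
  assumes "admissible r L A"
    and "cyclic_mult L"
    and "L \<noteq> {1}"
  shows "interprets_arith (Fgroup r L A) Fmul (Finv r) Fone"
proof -
  obtain g0 where g0: "L = {g0 powi k | k::int. True}" using assms(2) unfolding cyclic_mult_def by blast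
  have adm: "r > 0" "L \<subseteq> {0<..}" "add_subgroup A" "r \<in> A" "\<And>l a. l \<in> L \<Longrightarrow> a \<in> A \<Longrightarrow> l * a \<in> A"
    using assms(1) unfolding admissible_def mult_subgroup_pos_def by auto
  have "g0 powi 1 \<in> L" unfolding g0 by blast
  then have "0 < g0" using adm(2) by auto
  moreover have "g0 \<noteq> 1" using assms(3) g0 by auto
  \<comment> \<open>The inverse of a generator generates the same group, so a generator above
    \<open>1\<close> can be chosen.\<close>
  moreover have inv: "L = {inverse g0 powi k | k::int. True}"
  proof -
    have "g0 powi k = inverse g0 powi (- k)" "inverse g0 powi k = g0 powi (- k)" for k :: int
      by (simp_all add: power_int_minus power_int_inverse)
    then show ?thesis unfolding g0 by blast
  qed
  ultimately obtain g where g: "1 < g" "L = {g powi k | k::int. True}"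
    using g0 one_less_inverse[of g0] by (metis linorder_neqE)
  interpret pl_data r g A
    by unfold_locales (use adm g in auto)
  show ?thesis using G.interprets_arith unfolding g(2) Fgroup_eq .
qed

end
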